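(* Let $\ell\ge 2$ and let $\mathbf G$ be ${\rm GL}_n$ or ${\rm SL}_n$. For every non-degenerate character $\theta$ of $\mathbf U(\mathfrak o_\ell)$, the representation $\mathrm{Ind}_{\mathbf U(\mathfrak o_\ell)}^{\mathbf G(\mathfrak o_\ell)}(\theta)$ of $\mathbf G(\mathfrak o_\ell)$ is multiplicity free; equivalently, for every irreducible complex representation $\pi$ of $\mathbf G(\mathfrak o_\ell)$, $\dim \mathrm{Hom}_{\mathbf G(\mathfrak o_\ell)}\big(\pi,\mathrm{Ind}_{\mathbf U(\mathfrak o_\ell)}^{\mathbf G(\mathfrak o_\ell)}(\theta)\big)\le 1$.
   Context: Let $\mathbf F$ be a non-archimedean local field with ring of integers $\mathfrak o$, maximal ideal $\mathfrak p=\varpi\mathfrak o$, and finite residue field $\mathbf k=\mathfrak o/\mathfrak p\cong\mathbb F_q$ of characteristic $p$. For $r\ge 1$ put $\mathfrak o_r=\mathfrak o/\mathfrak p^r$. $\mathbf U(\mathfrak o_\ell)$ denotes the group of upper triangular unipotent matrices in $\mathbf G(\mathfrak o_\ell)$. A character $\varphi:(\mathfrak o_\ell,+)\to\mathbb C^\times$ is primitive if its restriction to $\varpi^{\ell-1}\mathfrak o_\ell$ is nontrivial. A non-degenerate character of $\mathbf U(\mathfrak o_\ell)$ is a character of the form $\theta((u_{ij}))=\varphi_1(u_{12})\varphi_2(u_{23})\cdots\varphi_{n-1}(u_{n-1,n})$ where $\varphi_1,\dots,\varphi_{n-1}$ are primitive characters of $\mathfrak o_\ell$. All representations are finite-dimensional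 complex representations. *)

theory Defs
  imports "Jordan_Normal_Form.Determinant"
begin

text \<open>An integral domain o with element w is the ring of integers of a
non-archimedean local field with uniformizer w iff: o is a discrete valuation
ring with uniformizer w (w nonzero non-unit, every nonzero element is a unit
times a power of w), the residue field o/wo is finite, and o is complete
for the w-adic topology.\<close>

definition ring_of_integers_local_field :: "'a::idom \<Rightarrow> bool" where
  "ring_of_integers_local_field w \<longleftrightarrow>
     w \<noteq> 0 \<and> \<not> w dvd 1 \<and>
     (\<forall>x. x \<noteq> 0 \<longrightarrow> (\<exists>u k. u dvd 1 \<and> x = u * w ^ k)) \<and>
     finite ((UNIV :: 'a set) // {(x, y). w dvd (x - y)}) \<and>
     (\<forall>s :: nat \<Rightarrow> 'a. (\<forall>k. w ^ k dvd (s (Suc k) - s k)) \<longrightarrow>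
         (\<exists>x. \<forall>k. w ^ k dvd (x - s k)))"

definition is_quotient_mod_power :: "'a::idom \<Rightarrow> nat \<Rightarrow> ('a \<Rightarrow> 'r::comm_ring_1) \<Rightarrow> bool" where
  "is_quotient_mod_power w l phi \<longleftrightarrow>
     phi 1 = 1 \<and> (\<forall>x y. phi (x + y) = phi x + phi y) \<and>
     (\<forall>x y. phi (x * y) = phi x * phi y) \<and> surj phi \<and>
     (\<forall>x. phi x = 0 \<longleftrightarrow> w ^ l dvd x)"

definition GLn :: "nat \<Rightarrow> 'r::comm_ring_1 mat set" where
  "GLn n = {A \<in> carrier_mat n n. det A dvd 1}"

definition SLn :: "nat \<Rightarrow> 'r::comm_ring_1 mat set" where
  "SLn n = {A \<in> carrier_mat n n. det A = 1}"

definition UTn :: "nat \<Rightarrow> 'r::comm_ring_1 mat set" where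
  "UTn n = {A \<in> carrier_mat n n. \<forall>i<n. \<forall>j<n.
             (j < i \<longrightarrow> A $$ (i, j) = 0) \<and> (i = j \<longrightarrow> A $$ (i, j) = 1)}"

definition additive_character :: "('r::comm_ring_1 \<Rightarrow> complex) \<Rightarrow> bool" where
  "additive_character psi \<longleftrightarrow> (\<forall>x. psi x \<noteq> 0) \<and> (\<forall>x y. psi (x + y) = psi x * psi y)"

text \<open>Primitive: nontrivial on varpi^(l-1) o_l, where varpi = image of w.\<close>
definition primitive_character :: "'r::comm_ring_1 \<Rightarrow> nat \<Rightarrow> ('r \<Rightarrow> complex) \<Rightarrow> bool" where
  "primitive_character varpi l psi \<longleftrightarrow>
     additive_character psi \<and> (\<exists>x. psi (varpi ^ (l - 1) * x) \<noteq> 1)"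

definition nondeg_char :: "nat \<Rightarrow> (nat \<Rightarrow> 'r::comm_ring_1 \<Rightarrow> complex) \<Rightarrow> 'r mat \<Rightarrow> complex" where
  "nondeg_char n psi u = (\<Prod>i<n - 1. psi i (u $$ (i, i + 1)))"

definition is_rep :: "nat \<Rightarrow> 'r::comm_ring_1 mat set \<Rightarrow> nat \<Rightarrow> ('r mat \<Rightarrow> complex mat) \<Rightarrow> bool" where
  "is_rep n G d rho \<longleftrightarrow>
     (\<forall>A\<in>G. rho A \<in> carrier_mat d d) \<and> rho (1\<^sub>m n) = 1\<^sub>m d \<and>
     (\<forall>A\<in>G. \<forall>B\<in>G. rho (A * B) = rho A * rho B)"

definition is_subspace :: "nat \<Rightarrow> complex vec set \<Rightarrow> bool" where
  "is_subspace d W \<longleftrightarrow> W \<subseteq> carrier_vec d \<and> 0\<^sub>v d \<in> W \<and>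
     (\<forall>v\<in>W. \<forall>w\<in>W. v + w \<in> W) \<and> (\<forall>c. \<forall>v\<in>W. c \<cdot>\<^sub>v v \<in> W)"

definition irreducible_rep :: "nat \<Rightarrow> 'r::comm_ring_1 mat set \<Rightarrow> nat \<Rightarrow> ('r mat \<Rightarrow> complex mat) \<Rightarrow> bool" where
  "irreducible_rep n G d rho \<longleftrightarrow> is_rep n G d rho \<and> d > 0 \<and>
     (\<forall>W. is_subspace d W \<and> (\<forall>A\<in>G. \<forall>w\<in>W. rho A *\<^sub>v w \<in> W) \<longrightarrow>
          W = {0\<^sub>v d} \<or> W = carrier_vec d)"

definition ind_space :: "'r::comm_ring_1 mat set \<Rightarrow> 'r mat set \<Rightarrow> ('r mat \<Rightarrow> complex) \<Rightarrow> ('r mat \<Rightarrow> complex) set" where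
  "ind_space G U theta = {f. (\<forall>x. x \<notin> G \<longrightarrow> f x = 0) \<and>
      (\<forall>u\<in>U. \<forall>g\<in>G. f (u * g) = theta u * f g)}"

definition ind_action :: "'r::comm_ring_1 mat set \<Rightarrow> 'r mat \<Rightarrow> ('r mat \<Rightarrow> complex) \<Rightarrow> ('r mat \<Rightarrow> complex)" where
  "ind_action G g f = (\<lambda>x. if x \<in> G then f (x * g) else 0)"

definition intertwiner ::
  "'r::comm_ring_1 mat set \<Rightarrow> 'r mat set \<Rightarrow> ('r mat \<Rightarrow> complex) \<Rightarrow> nat \<Rightarrow> ('r mat \<Rightarrow> complex mat)
     \<Rightarrow> (complex vec \<Rightarrow> ('r mat \<Rightarrow> complex)) \<Rightarrow> bool" where
  "intertwiner G U theta d rho T \<longleftrightarrow>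
     (\<forall>v\<in>carrier_vec d. T v \<in> ind_space G U theta) \<and>
     (\<forall>v\<in>carrier_vec d. \<forall>w\<in>carrier_vec d. T (v + w) = (\<lambda>x. T v x + T w x)) \<and>
     (\<forall>c. \<forall>v\<in>carrier_vec d. T (c \<cdot>\<^sub>v v) = (\<lambda>x. c * T v x)) \<and>
     (\<forall>g\<in>G. \<forall>v\<in>carrier_vec d. T (rho g *\<^sub>v v) = ind_action G g (T v))"

definition hom_dim_le_1 ::
  "'r::comm_ring_1 mat set \<Rightarrow> 'r mat set \<Rightarrow> ('r mat \<Rightarrow> complex) \<Rightarrow> nat \<Rightarrow> ('r mat \<Rightarrow> complex mat) \<Rightarrow> bool" where
  "hom_dim_le_1 G U theta d rho \<longleftrightarrow>
     (\<forall>T1 T2. intertwiner G U theta d rho T1 \<and> intertwiner G U theta d rho T2 \<longrightarrow>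
        (\<exists>c1 c2. (c1 \<noteq> 0 \<or> c2 \<noteq> 0) \<and>
           (\<forall>v\<in>carrier_vec d. \<forall>x. c1 * T1 v x + c2 * T2 v x = 0)))"

end

theory Submission
  imports Defs "Jordan_Normal_Form.Spectral_Radius"
begin

text \<open>
  Gelfand's trick. Write \<open>theta u = psi (tr (u J))\<close> with \<open>J\<close> supported on the subdiagonal, with
  unit entries there. A twisted transpose \<open>sigma\<close> along the antidiagonal is an anti-automorphism of
  \<open>G\<close> that preserves \<open>U\<close> and fixes \<open>J\<close>, hence preserves \<open>theta\<close>; it suffices that it fixes every
  function \<open>f\<close> with \<open>f (u g v) = theta u * theta v * f g\<close>.

  There is no usable Bruhat decomposition over a quotient of the ring of integers. Instead, if
  \<open>f g \<noteq> 0\<close> then duality for the trace pairing yields \<open>A g = g B\<close> with \<open>A\<close> and \<open>B\<close> Hessenberg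
  matrices with subdiagonal \<open>J\<close>. The first basis vector is cyclic for such matrices, so they are
  conjugate under \<open>U\<close> as soon as they satisfy the same monic equation of degree \<open>n\<close>, and only
  polynomials in them commute with them. Hence \<open>g = u z\<close> with \<open>z\<close> a polynomial in \<open>B\<close>, and
  \<open>sigma z\<close> is the same polynomial in \<open>sigma B\<close>, which is \<open>U\<close>-conjugate to \<open>B\<close>.

  Primitivity enters only through the fact that a primitive character of the finite ring generates
  its group of additive characters as a module.
\<close>

section \<open>Linear combinations of matrices\<close>

lemma index_mult_mat_sum:
  assumes "A \<in> carrier_mat m n" "B \<in> carrier_mat n k" "i < m" "j < k"
  shows "(A * B) $$ (i, j) = (\<Sum>l<n. A $$ (i, l) * B $$ (l, j))"
  using assms by (simp add: scalar_prod_def atLeast0LessThan)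

lemma left_inverse_mult_cancel:
  fixes X :: "'a::semiring_1 mat"
  assumes "h \<in> carrier_mat n n" "g \<in> carrier_mat n n" "h * g = 1\<^sub>m n" "X \<in> carrier_mat n m"
  shows "h * (g * X) = X"
  using assms assoc_mult_mat[OF assms(1,2,4)] by simp

lemma eq_vec_scalar_prodI:
  fixes v w :: "'a::semiring_1 vec"
  assumes "v \<in> carrier_vec n" "w \<in> carrier_vec n"
    and "\<And>l. l \<in> carrier_vec n \<Longrightarrow> l \<bullet> v = l \<bullet> w"
  shows "v = w"
proof (rule eq_vecI)
  fix i assume "i < dim_vec w"
  then show "v $ i = w $ i" using assms(1,2) assms(3)[of "unit_vec n i"] by simp
qed (use assms(1,2) in simp)

lemma eq_zero_vecI_scalar_prod:
  fixes l :: "'a::semiring_1 vec"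
  assumes "l \<in> carrier_vec n" "\<And>v. v \<in> carrier_vec n \<Longrightarrow> l \<bullet> v = 0"
  shows "l = 0\<^sub>v n"
proof (rule eq_vecI)
  fix i assume "i < dim_vec (0\<^sub>v n :: 'a vec)"
  then show "l $ i = 0\<^sub>v n $ i" using assms(1) assms(2)[of "unit_vec n i"] by simp
qed (use assms(1) in simp)

lemma linear_functional_eq_scalar_prod:
  fixes f :: "'a::comm_semiring_1 vec \<Rightarrow> 'a"
  assumes add: "\<And>v w. v \<in> carrier_vec n \<Longrightarrow> w \<in> carrier_vec n \<Longrightarrow> f (v + w) = f v + f w"
    and smult: "\<And>c v. v \<in> carrier_vec n \<Longrightarrow> f (c \<cdot>\<^sub>v v) = c * f v"
  obtains l where "l \<in> carrier_vec n" "\<And>v. v \<in> carrier_vec n \<Longrightarrow> f v = l \<bullet> v"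
proof -
  define l where "l = vec n (\<lambda>i. f (unit_vec n i))"
  have l: "l \<in> carrier_vec n" by (simp add: l_def)
  have "0 \<cdot>\<^sub>v 0\<^sub>v n = (0\<^sub>v n :: 'a vec)" by auto
  then have zero: "f (0\<^sub>v n) = 0" using smult[of "0\<^sub>v n" 0] by simp
  have truncated: "f (vec n (\<lambda>i. if i < k then v $ i else 0)) = (\<Sum>i<k. l $ i * v $ i)"
    if "k \<le> n" for v k
    using that
  proof (induction k)
    case 0
    have "vec n (\<lambda>i. if i < 0 then v $ i else 0) = 0\<^sub>v n" by auto
    then show ?case by (simp add: zero)
  next
    case (Suc k)
    have "vec n (\<lambda>i. if i < Suc k then v $ i else 0)
        = vec n (\<lambda>i. if i < k then v $ i else 0) + v $ k \<cdot>\<^sub>v unit_vec n k"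
      using Suc.prems by (intro eq_vecI) (auto simp: less_Suc_eq)
    then show ?case using Suc by (simp add: add smult l_def mult.commute)
  qed
  have "f v = l \<bullet> v" if v: "v \<in> carrier_vec n" for v
  proof -
    have "vec n (\<lambda>i. if i < n then v $ i else 0) = v" using v by auto
    then show ?thesis using truncated[of n v] v by (simp add: scalar_prod_def atLeast0LessThan)
  qed
  with l show thesis by (rule that)
qed

definition mat_lincomb ::
  "nat \<Rightarrow> nat \<Rightarrow> 'i set \<Rightarrow> ('i \<Rightarrow> 'a::comm_semiring_0) \<Rightarrow> ('i \<Rightarrow> 'a mat) \<Rightarrow> 'a mat" where
  "mat_lincomb nr nc S c X = mat nr nc (\<lambda>ij. \<Sum>k\<in>S. c k * X k $$ ij)"

lemma mat_lincomb_carrier [simp]: "mat_lincomb nr nc S c X \<in> carrier_mat nr nc"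
  by (simp add: mat_lincomb_def)

lemma dim_mat_lincomb [simp]:
  "dim_row (mat_lincomb nr nc S c X) = nr" "dim_col (mat_lincomb nr nc S c X) = nc"
  by (simp_all add: mat_lincomb_def)

lemma index_mat_lincomb [simp]:
  "i < nr \<Longrightarrow> j < nc \<Longrightarrow> mat_lincomb nr nc S c X $$ (i, j) = (\<Sum>k\<in>S. c k * X k $$ (i, j))"
  by (simp add: mat_lincomb_def)

lemma mat_lincomb_cong:
  "(\<And>k. k \<in> S \<Longrightarrow> X k = Y k) \<Longrightarrow> mat_lincomb nr nc S c X = mat_lincomb nr nc S c Y"
  by (simp add: mat_lincomb_def)

lemma mult_mat_lincomb:
  assumes A: "A \<in> carrier_mat m nr" and X: "\<And>k. k \<in> S \<Longrightarrow> X k \<in> carrier_mat nr nc"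
  shows "A * mat_lincomb nr nc S c X = mat_lincomb m nc S c (\<lambda>k. A * X k)"
proof (rule eq_matI)
  fix i j
  assume "i < dim_row (mat_lincomb m nc S c (\<lambda>k. A * X k))"
    "j < dim_col (mat_lincomb m nc S c (\<lambda>k. A * X k))"
  then have ij: "i < m" "j < nc" by auto
  have "(A * mat_lincomb nr nc S c X) $$ (i, j)
      = (\<Sum>l<nr. \<Sum>k\<in>S. c k * (A $$ (i, l) * X k $$ (l, j)))"
    using ij by (simp add: index_mult_mat_sum[OF A mat_lincomb_carrier] sum_distrib_left
        mult.left_commute del: index_mult_mat(1))
  also have "\<dots> = (\<Sum>k\<in>S. c k * (\<Sum>l<nr. A $$ (i, l) * X k $$ (l, j)))"
    by (subst sum.swap) (simp add: sum_distrib_left)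
  finally show "(A * mat_lincomb nr nc S c X) $$ (i, j)
      = mat_lincomb m nc S c (\<lambda>k. A * X k) $$ (i, j)"
    using ij by (simp add: index_mult_mat_sum[OF A X] del: index_mult_mat(1))
qed (use A in auto)

lemma transpose_mat_lincomb:
  assumes "\<And>k. k \<in> S \<Longrightarrow> X k \<in> carrier_mat nr nc"
  shows "(mat_lincomb nr nc S c X)\<^sup>T = mat_lincomb nc nr S c (\<lambda>k. (X k)\<^sup>T)"
proof (rule eq_matI)
  fix i j
  assume "i < dim_row (mat_lincomb nc nr S c (\<lambda>k. (X k)\<^sup>T))"
    "j < dim_col (mat_lincomb nc nr S c (\<lambda>k. (X k)\<^sup>T))"
  then have ij: "i < nc" "j < nr" by auto
  then have "(X k)\<^sup>T $$ (i, j) = X k $$ (j, i)" if "k \<in> S" for k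
    using assms[OF that] by simp
  then show "(mat_lincomb nr nc S c X)\<^sup>T $$ (i, j) = mat_lincomb nc nr S c (\<lambda>k. (X k)\<^sup>T) $$ (i, j)"
    using ij by simp
qed auto

lemma mat_lincomb_mult:
  assumes A: "A \<in> carrier_mat nc m" and X: "\<And>k. k \<in> S \<Longrightarrow> X k \<in> carrier_mat nr nc"
  shows "mat_lincomb nr nc S c X * A = mat_lincomb nr m S c (\<lambda>k. X k * A)"
proof -
  have "(mat_lincomb nr nc S c X * A)\<^sup>T = mat_lincomb m nr S c (\<lambda>k. A\<^sup>T * (X k)\<^sup>T)"
    using A X by (simp add: transpose_mult[OF mat_lincomb_carrier A] transpose_mat_lincomb
        mult_mat_lincomb[of _ m nc])
  also have "\<dots> = mat_lincomb m nr S c (\<lambda>k. (X k * A)\<^sup>T)"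
    by (intro mat_lincomb_cong) (simp add: transpose_mult[OF X A])
  also have "\<dots> = (mat_lincomb nr m S c (\<lambda>k. X k * A))\<^sup>T"
    using A X by (subst transpose_mat_lincomb) (auto intro: mult_carrier_mat)
  finally show ?thesis by simp
qed

lemma scalar_prod_mat_lincomb:
  assumes X: "\<And>k. k \<in> S \<Longrightarrow> X k \<in> carrier_mat nr nc"
    and l: "l \<in> carrier_vec nr" and v: "v \<in> carrier_vec nc"
  shows "l \<bullet> (mat_lincomb nr nc S c X *\<^sub>v v) = (\<Sum>k\<in>S. c k * (l \<bullet> (X k *\<^sub>v v)))"
proof -
  have pairing: "l \<bullet> (A *\<^sub>v v) = (\<Sum>i<nr. \<Sum>j<nc. l $ i * (A $$ (i, j) * v $ j))"
    if "A \<in> carrier_mat nr nc" for A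
    using that v by (simp add: scalar_prod_def sum_distrib_left atLeast0LessThan)
  have "l \<bullet> (mat_lincomb nr nc S c X *\<^sub>v v)
      = (\<Sum>i<nr. \<Sum>j<nc. \<Sum>k\<in>S. c k * (l $ i * (X k $$ (i, j) * v $ j)))"
    by (simp add: pairing sum_distrib_left sum_distrib_right ac_simps)
  also have "\<dots> = (\<Sum>k\<in>S. \<Sum>i<nr. \<Sum>j<nc. c k * (l $ i * (X k $$ (i, j) * v $ j)))"
    by (simp add: sum.swap[of _ S])
  also have "\<dots> = (\<Sum>k\<in>S. c k * (l \<bullet> (X k *\<^sub>v v)))"
    by (simp add: pairing[OF X] sum_distrib_left)
  finally show ?thesis .
qed

section \<open>Irreducible representations of finite matrix groups\<close>

locale mat_group =
  fixes n :: nat and G :: "'r::comm_ring_1 mat set"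
  assumes carrier: "G \<subseteq> carrier_mat n n"
    and one_closed: "1\<^sub>m n \<in> G"
    and mult_closed: "\<And>g h. g \<in> G \<Longrightarrow> h \<in> G \<Longrightarrow> g * h \<in> G"
    and inverse_closed: "\<And>g. g \<in> G \<Longrightarrow> \<exists>h\<in>G. g * h = 1\<^sub>m n \<and> h * g = 1\<^sub>m n"
begin

lemma carrierD: "g \<in> G \<Longrightarrow> g \<in> carrier_mat n n"
  using carrier by auto

lemma bij_betw_mult_left:
  assumes g: "g \<in> G"
  shows "bij_betw ((*) g) G G"
proof -
  obtain h where h: "h \<in> G" "g * h = 1\<^sub>m n" "h * g = 1\<^sub>m n" using inverse_closed[OF g] by auto
  show ?thesis
    by (rule bij_betwI[where g = "(*) h"])
      (use g h carrierD in \<open>auto intro: mult_closed left_inverse_mult_cancel\<close>)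
qed

lemma mult_left_mem_iff:
  assumes g: "g \<in> G" and k: "k \<in> carrier_mat n n"
  shows "g * k \<in> G \<longleftrightarrow> k \<in> G"
proof
  obtain h where h: "h \<in> G" "h * g = 1\<^sub>m n" using inverse_closed[OF g] by auto
  then have "h * (g * k) = k" using left_inverse_mult_cancel carrierD g k by blast
  then show "k \<in> G" if "g * k \<in> G" using mult_closed[OF h(1) that] by simp
qed (rule mult_closed[OF g])

end

locale irreducible_mat_rep = mat_group n G for n and G :: "'r::comm_ring_1 mat set" +
  fixes d :: nat and rho :: "'r mat \<Rightarrow> complex mat"
  assumes finite_group: "finite G" and irreducible: "irreducible_rep n G d rho"
begin

lemma rho_carrier [simp]: "g \<in> G \<Longrightarrow> rho g \<in> carrier_mat d d"
  and rho_one: "rho (1\<^sub>m n) = 1\<^sub>m d"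
  and rho_mult: "g \<in> G \<Longrightarrow> h \<in> G \<Longrightarrow> rho (g * h) = rho g * rho h"
  and dim_pos: "d > 0"
  using irreducible by (auto simp: irreducible_rep_def is_rep_def)

lemma rho_vec_carrier [simp]: "g \<in> G \<Longrightarrow> v \<in> carrier_vec d \<Longrightarrow> rho g *\<^sub>v v \<in> carrier_vec d"
  using rho_carrier by (meson mult_mat_vec_carrier)

lemma rho_mult_vec:
  "g \<in> G \<Longrightarrow> h \<in> G \<Longrightarrow> v \<in> carrier_vec d \<Longrightarrow> rho g *\<^sub>v (rho h *\<^sub>v v) = rho (g * h) *\<^sub>v v"
  by (simp add: rho_mult assoc_mult_mat_vec[OF rho_carrier rho_carrier])

lemma rho_add_vec:
  "g \<in> G \<Longrightarrow> v \<in> carrier_vec d \<Longrightarrow> w \<in> carrier_vec d \<Longrightarrow> rho g *\<^sub>v (v + w) = rho g *\<^sub>v v + rho g *\<^sub>v w"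
  by (rule mult_add_distrib_mat_vec[OF rho_carrier])

lemma rho_smult_vec:
  "g \<in> G \<Longrightarrow> v \<in> carrier_vec d \<Longrightarrow> rho g *\<^sub>v (c \<cdot>\<^sub>v v) = c \<cdot>\<^sub>v (rho g *\<^sub>v v)"
  by (rule mult_mat_vec[OF rho_carrier])

lemma invariant_subspace_trivial:
  assumes "is_subspace d W" "\<And>g w. g \<in> G \<Longrightarrow> w \<in> W \<Longrightarrow> rho g *\<^sub>v w \<in> W"
  shows "W = {0\<^sub>v d} \<or> W = carrier_vec d"
  using irreducible assms unfolding irreducible_rep_def by blast

lemma matrix_coefficient_eq_zero:
  assumes l: "l \<in> carrier_vec d" and v: "v \<in> carrier_vec d"
    and vanish: "\<And>g. g \<in> G \<Longrightarrow> l \<bullet> (rho g *\<^sub>v v) = 0"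
  shows "l = 0\<^sub>v d \<or> v = 0\<^sub>v d"
proof -
  define W where "W = {x \<in> carrier_vec d. \<forall>g\<in>G. l \<bullet> (rho g *\<^sub>v x) = 0}"
  have "rho g *\<^sub>v 0\<^sub>v d = 0\<^sub>v d" if "g \<in> G" for g
    using rho_carrier[OF that] by auto
  then have "is_subspace d W"
    using l by (auto simp: is_subspace_def W_def rho_add_vec rho_smult_vec
        scalar_prod_add_distrib[of _ d])
  moreover have "rho g *\<^sub>v x \<in> W" if "g \<in> G" "x \<in> W" for g x
    using that by (auto simp: W_def rho_mult_vec mult_closed)
  ultimately consider (zero) "W = {0\<^sub>v d}" | (all) "W = carrier_vec d"
    using invariant_subspace_trivial by blast
  then show ?thesis
  proof cases
    case zero
    moreover have "v \<in> W" using v vanish by (simp add: W_def)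
    ultimately show ?thesis by simp
  next
    case all
    then have "l \<bullet> x = 0" if "x \<in> carrier_vec d" for x
      using that one_closed rho_one by (force simp: W_def)
    then show ?thesis using eq_zero_vecI_scalar_prod[OF l] by simp
  qed
qed

definition rho_sum :: "('r mat \<Rightarrow> complex) \<Rightarrow> complex mat" where
  "rho_sum F = mat_lincomb d d G F rho"

lemma rho_sum_carrier [simp]: "rho_sum F \<in> carrier_mat d d"
  by (simp add: rho_sum_def)

lemma rho_sum_vec_carrier [simp]: "w \<in> carrier_vec d \<Longrightarrow> rho_sum F *\<^sub>v w \<in> carrier_vec d"
  by (rule mult_mat_vec_carrier[OF rho_sum_carrier])

lemma scalar_prod_rho_sum:
  "l \<in> carrier_vec d \<Longrightarrow> w \<in> carrier_vec d \<Longrightarrow>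
    l \<bullet> (rho_sum F *\<^sub>v w) = (\<Sum>g\<in>G. F g * (l \<bullet> (rho g *\<^sub>v w)))"
  unfolding rho_sum_def by (rule scalar_prod_mat_lincomb[OF rho_carrier])

lemma rho_mult_rho_sum:
  assumes "g \<in> G"
  shows "rho g * rho_sum F = mat_lincomb d d G F (\<lambda>h. rho (g * h))"
  unfolding rho_sum_def using assms
  by (subst mult_mat_lincomb) (auto intro!: mat_lincomb_cong simp: rho_mult)

lemma scalar_prod_rho_rho_sum:
  assumes "g \<in> G" "l \<in> carrier_vec d" "w \<in> carrier_vec d"
  shows "l \<bullet> (rho g *\<^sub>v (rho_sum F *\<^sub>v w)) = (\<Sum>h\<in>G. F h * (l \<bullet> (rho (g * h) *\<^sub>v w)))"
  using assms by (simp add: assoc_mult_mat_vec[OF rho_carrier rho_sum_carrier, symmetric]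
      rho_mult_rho_sum scalar_prod_mat_lincomb mult_closed)

lemma rho_rho_sum_translate:
  assumes g: "g \<in> G" and h: "h \<in> G" "h * g = 1\<^sub>m n" and w: "w \<in> carrier_vec d"
  shows "rho g *\<^sub>v (rho_sum F *\<^sub>v w) = rho_sum (\<lambda>k. F (h * k)) *\<^sub>v w"
proof (rule eq_vec_scalar_prodI)
  have cancel: "h * (g * k) = k" if "k \<in> G" for k
    by (rule left_inverse_mult_cancel) (use g h that carrierD in auto)
  fix l :: "complex vec" assume l: "l \<in> carrier_vec d"
  have "l \<bullet> (rho g *\<^sub>v (rho_sum F *\<^sub>v w)) = (\<Sum>k\<in>G. F (h * (g * k)) * (l \<bullet> (rho (g * k) *\<^sub>v w)))"
    by (simp add: scalar_prod_rho_rho_sum[OF g l w] cancel)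
  also have "\<dots> = (\<Sum>k\<in>G. F (h * k) * (l \<bullet> (rho k *\<^sub>v w)))"
    by (rule sum.reindex_bij_betw[OF bij_betw_mult_left[OF g]])
  finally show "l \<bullet> (rho g *\<^sub>v (rho_sum F *\<^sub>v w)) = l \<bullet> (rho_sum (\<lambda>k. F (h * k)) *\<^sub>v w)"
    by (simp add: scalar_prod_rho_sum[OF l w])
qed (use g w in simp_all)

lemma rho_sum_indicator_one:
  assumes w: "w \<in> carrier_vec d"
  shows "rho_sum (\<lambda>g. if g = 1\<^sub>m n then 1 else 0) *\<^sub>v w = w"
proof (rule eq_vec_scalar_prodI)
  fix l :: "complex vec" assume "l \<in> carrier_vec d"
  then show "l \<bullet> (rho_sum (\<lambda>g. if g = 1\<^sub>m n then 1 else 0) *\<^sub>v w) = l \<bullet> w"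
    using w finite_group one_closed
    by (simp add: scalar_prod_rho_sum if_distrib[of "\<lambda>c. c * _"] rho_one cong: if_cong)
qed (use w in simp_all)

lemma is_subspace_range_rho_sum:
  assumes w: "w \<in> carrier_vec d"
  shows "is_subspace d (range (\<lambda>F. rho_sum F *\<^sub>v w))"
  unfolding is_subspace_def
proof (intro conjI ballI allI; (elim rangeE)?)
  show "0\<^sub>v d \<in> range (\<lambda>F. rho_sum F *\<^sub>v w)"
    by (intro range_eqI[of _ _ "\<lambda>_. 0"], intro eq_vec_scalar_prodI[of _ d])
      (use w in \<open>simp_all add: scalar_prod_rho_sum\<close>)
next
  fix c x F assume "x = rho_sum F *\<^sub>v w"
  then show "c \<cdot>\<^sub>v x \<in> range (\<lambda>F. rho_sum F *\<^sub>v w)"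
    by (intro range_eqI[of _ _ "\<lambda>g. c * F g"], intro eq_vec_scalar_prodI[of _ d])
      (use w in \<open>simp_all add: scalar_prod_rho_sum sum_distrib_left mult.assoc\<close>)
next
  fix x y F F' assume "x = rho_sum F *\<^sub>v w" "y = rho_sum F' *\<^sub>v w"
  then show "x + y \<in> range (\<lambda>F. rho_sum F *\<^sub>v w)"
    by (intro range_eqI[of _ _ "\<lambda>g. F g + F' g"], intro eq_vec_scalar_prodI[of _ d])
      (use w in \<open>simp_all add: scalar_prod_rho_sum scalar_prod_add_distrib[of _ d] sum.distrib
          distrib_right\<close>)
qed (use w in auto)

lemma rho_sum_surj:
  assumes w: "w \<in> carrier_vec d" "w \<noteq> 0\<^sub>v d" and v: "v \<in> carrier_vec d"
  obtains F where "rho_sum F *\<^sub>v w = v"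
proof -
  let ?W = "range (\<lambda>F. rho_sum F *\<^sub>v w)"
  have "rho g *\<^sub>v x \<in> ?W" if g: "g \<in> G" and "x \<in> ?W" for g x
  proof -
    obtain F where "x = rho_sum F *\<^sub>v w" using \<open>x \<in> ?W\<close> by auto
    then show ?thesis using inverse_closed[OF g] rho_rho_sum_translate[OF g _ _ w(1)] by auto
  qed
  then have "?W = {0\<^sub>v d} \<or> ?W = carrier_vec d"
    by (rule invariant_subspace_trivial[OF is_subspace_range_rho_sum[OF w(1)]])
  moreover have "w \<in> ?W" using rho_sum_indicator_one[OF w(1)] by (metis rangeI)
  ultimately have "v \<in> ?W" using w(2) v by auto
  then show thesis using that by auto
qed

lemma index_rho_sum_vec:
  assumes "w \<in> carrier_vec d" "i < d"
  shows "(rho_sum F *\<^sub>v w) $ i = (\<Sum>g\<in>G. F g * (rho g *\<^sub>v w) $ i)"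
  using scalar_prod_rho_sum[OF unit_vec_carrier assms(1), of i F] assms
  by (simp add: scalar_prod_left_unit[of _ d] del: index_mult_mat_vec)

lemma index_rho_sum_lincomb_vec:
  assumes w: "w \<in> carrier_vec d" and i: "i < d"
  shows "(rho_sum (\<lambda>g. \<Sum>j\<in>J. c j * F j g) *\<^sub>v w) $ i = (\<Sum>j\<in>J. c j * (rho_sum (F j) *\<^sub>v w) $ i)"
proof -
  have "(rho_sum (\<lambda>g. \<Sum>j\<in>J. c j * F j g) *\<^sub>v w) $ i
      = (\<Sum>g\<in>G. \<Sum>j\<in>J. c j * (F j g * (rho g *\<^sub>v w) $ i))"
    by (simp add: index_rho_sum_vec[OF w i] sum_distrib_right mult.assoc del: index_mult_mat_vec)
  also have "\<dots> = (\<Sum>j\<in>J. c j * (rho_sum (F j) *\<^sub>v w) $ i)"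
    by (subst sum.swap)
      (simp add: index_rho_sum_vec[OF w i] sum_distrib_left del: index_mult_mat_vec)
  finally show ?thesis .
qed

text \<open>A form of Schur's lemma: if \<open>rho_sum F w1 \<mapsto> rho_sum F w2\<close> were a well defined map, it would be an
  endomorphism, and \<open>rho_sum F w1\<close> is an eigenvector of it.\<close>
lemma rho_sum_eigenvector:
  assumes w1: "w1 \<in> carrier_vec d" "w1 \<noteq> 0\<^sub>v d" and w2: "w2 \<in> carrier_vec d"
  obtains F c where "rho_sum F *\<^sub>v w1 \<noteq> 0\<^sub>v d" "rho_sum F *\<^sub>v w2 = c \<cdot>\<^sub>v (rho_sum F *\<^sub>v w1)"
proof -
  have "\<exists>F. rho_sum F *\<^sub>v w1 = unit_vec d j" for j
    using rho_sum_surj[OF w1] by (metis unit_vec_carrier)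
  then obtain E where E: "\<And>j. rho_sum (E j) *\<^sub>v w1 = unit_vec d j" by metis
  define L where "L = mat d d (\<lambda>(i, j). (rho_sum (E j) *\<^sub>v w2) $ i)"
  have L: "L \<in> carrier_mat d d" by (simp add: L_def)
  obtain c x where "eigenvector L x c"
    using spectrum_non_empty[OF L dim_pos] by (auto simp: spectrum_def eigenvalue_def)
  then have x: "x \<in> carrier_vec d" "x \<noteq> 0\<^sub>v d" "L *\<^sub>v x = c \<cdot>\<^sub>v x"
    using L by (auto simp: eigenvector_def)
  define F where "F = (\<lambda>g. \<Sum>j<d. x $ j * E j g)"
  note index = index_rho_sum_lincomb_vec[of _ _ "($) x" E "{..<d}", folded F_def]
  have "rho_sum F *\<^sub>v w1 = x"
  proof (rule eq_vecI)
    fix i assume "i < dim_vec x"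
    then have i: "i < d" using x by simp
    have "(rho_sum F *\<^sub>v w1) $ i = (\<Sum>j<d. if i = j then x $ j else 0)"
      using i by (simp add: index[OF w1(1)] E if_distrib[of "(*) _"]
          del: index_mult_mat_vec cong: if_cong)
    then show "(rho_sum F *\<^sub>v w1) $ i = x $ i" using i by simp
  qed (use x in \<open>simp add: rho_sum_def\<close>)
  moreover have "rho_sum F *\<^sub>v w2 = L *\<^sub>v x"
  proof (rule eq_vecI)
    fix i assume "i < dim_vec (L *\<^sub>v x)"
    then have i: "i < d" using L by simp
    have "(L *\<^sub>v x) $ i = (\<Sum>j<d. L $$ (i, j) * x $ j)"
      using i L x(1) by (simp add: scalar_prod_def atLeast0LessThan)
    then show "(rho_sum F *\<^sub>v w2) $ i = (L *\<^sub>v x) $ i"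
      using i by (simp add: index[OF w2] L_def mult.commute del: index_mult_mat_vec)
  qed (use L in \<open>simp add: rho_sum_def\<close>)
  ultimately show thesis using that[of F c] x by simp
qed

end

section \<open>Gelfand's criterion\<close>

definition bi_equivariant ::
  "'r::comm_ring_1 mat set \<Rightarrow> 'r mat set \<Rightarrow> ('r mat \<Rightarrow> complex) \<Rightarrow> ('r mat \<Rightarrow> complex) \<Rightarrow> bool" where
  "bi_equivariant G U theta f \<longleftrightarrow>
     (\<forall>u\<in>U. \<forall>g\<in>G. f (u * g) = theta u * f g \<and> f (g * u) = theta u * f g)"

lemma bi_equivariantD:
  assumes "bi_equivariant G U theta f" "u \<in> U" "g \<in> G"
  shows "f (u * g) = theta u * f g" "f (g * u) = theta u * f g"
  using assms by (auto simp: bi_equivariant_def)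

lemma bi_equivariant_eq_zero:
  assumes f: "bi_equivariant G U theta f" and uv: "u \<in> U" "v \<in> U" and g: "g \<in> G"
    and eq: "u * g = g * v" and neq: "theta u \<noteq> theta v"
  shows "f g = 0"
  using bi_equivariantD(1)[OF f uv(1) g] bi_equivariantD(2)[OF f uv(2) g] eq neq by simp

locale gelfand_pair = G: mat_group n G + U: mat_group n U
  for n and G U :: "'r::comm_ring_1 mat set" +
  fixes theta :: "'r mat \<Rightarrow> complex" and sigma :: "'r mat \<Rightarrow> 'r mat"
  assumes subgroup: "U \<subseteq> G"
    and theta_mult: "\<And>u v. u \<in> U \<Longrightarrow> v \<in> U \<Longrightarrow> theta (u * v) = theta u * theta v"
    and theta_nonzero: "\<And>u. u \<in> U \<Longrightarrow> theta u \<noteq> 0"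
    and sigma_image: "sigma ` G = G"
    and sigma_mult: "\<And>g h. g \<in> G \<Longrightarrow> h \<in> G \<Longrightarrow> sigma (g * h) = sigma h * sigma g"
    and sigma_invariant: "\<And>f g. bi_equivariant G U theta f \<Longrightarrow> g \<in> G \<Longrightarrow> f (sigma g) = f g"
begin

lemma subgroupD: "u \<in> U \<Longrightarrow> u \<in> G"
  using subgroup by auto

lemma sigma_closed: "g \<in> G \<Longrightarrow> sigma g \<in> G"
  using sigma_image by blast

end

locale gelfand_pair_rep = gelfand_pair n G U theta sigma + irreducible_mat_rep n G d rho
  for n and G U :: "'r::comm_ring_1 mat set" and theta sigma d and rho :: "'r mat \<Rightarrow> complex mat"
begin

definition whittaker_vector :: "complex vec \<Rightarrow> bool" where
  "whittaker_vector w \<longleftrightarrow> w \<in> carrier_vec d \<and> (\<forall>u\<in>U. rho u *\<^sub>v w = theta u \<cdot>\<^sub>v w)"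

definition whittaker_covector :: "complex vec \<Rightarrow> bool" where
  "whittaker_covector l \<longleftrightarrow> l \<in> carrier_vec d \<and>
     (\<forall>u\<in>U. \<forall>v\<in>carrier_vec d. l \<bullet> (rho u *\<^sub>v v) = theta u * (l \<bullet> v))"

lemma whittaker_vector_carrier: "whittaker_vector w \<Longrightarrow> w \<in> carrier_vec d"
  by (simp add: whittaker_vector_def)

lemma whittaker_covector_carrier: "whittaker_covector l \<Longrightarrow> l \<in> carrier_vec d"
  by (simp add: whittaker_covector_def)

lemma whittaker_coefficient_sigma:
  assumes l: "whittaker_covector l" and w: "whittaker_vector w" and g: "g \<in> G"
  shows "l \<bullet> (rho (sigma g) *\<^sub>v w) = l \<bullet> (rho g *\<^sub>v w)"
proof -
  have "bi_equivariant G U theta (\<lambda>g. l \<bullet> (rho g *\<^sub>v w))"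
    unfolding bi_equivariant_def
  proof (intro ballI conjI)
    fix u g assume ug: "u \<in> U" "g \<in> G"
    then show "l \<bullet> (rho (u * g) *\<^sub>v w) = theta u * (l \<bullet> (rho g *\<^sub>v w))"
      using l w subgroupD by (simp add: rho_mult_vec[symmetric] whittaker_covector_def
          whittaker_vector_def)
    show "l \<bullet> (rho (g * u) *\<^sub>v w) = theta u * (l \<bullet> (rho g *\<^sub>v w))"
      using ug l w subgroupD by (simp add: rho_mult_vec[symmetric] rho_smult_vec
          scalar_prod_smult_distrib[of _ d] whittaker_covector_def whittaker_vector_def)
  qed
  then show ?thesis using sigma_invariant g by blast
qed

definition rho_sigma_sum :: "('r mat \<Rightarrow> complex) \<Rightarrow> complex mat" where
  "rho_sigma_sum F = mat_lincomb d d G F (\<lambda>g. rho (sigma g))"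

lemma rho_sigma_sum_carrier [simp]: "rho_sigma_sum F \<in> carrier_mat d d"
  by (simp add: rho_sigma_sum_def)

lemma whittaker_coefficient_rho_sum:
  assumes l: "whittaker_covector l" and w: "whittaker_vector w" and g: "g \<in> G"
  shows "l \<bullet> (rho g *\<^sub>v (rho_sum F *\<^sub>v w)) = l \<bullet> (rho_sigma_sum F *\<^sub>v (rho (sigma g) *\<^sub>v w))"
proof -
  note carrier = whittaker_covector_carrier[OF l] whittaker_vector_carrier[OF w]
  have "l \<bullet> (rho g *\<^sub>v (rho_sum F *\<^sub>v w)) = (\<Sum>h\<in>G. F h * (l \<bullet> (rho (sigma (g * h)) *\<^sub>v w)))"
    using g by (simp add: scalar_prod_rho_rho_sum carrier whittaker_coefficient_sigma[OF l w]
        G.mult_closed)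
  also have "\<dots> = (\<Sum>h\<in>G. F h * (l \<bullet> (rho (sigma h) *\<^sub>v (rho (sigma g) *\<^sub>v w))))"
    using g carrier by (simp add: sigma_mult rho_mult_vec sigma_closed)
  also have "\<dots> = l \<bullet> (rho_sigma_sum F *\<^sub>v (rho (sigma g) *\<^sub>v w))"
    unfolding rho_sigma_sum_def using g carrier sigma_closed
    by (intro scalar_prod_mat_lincomb[symmetric]) auto
  finally show ?thesis .
qed

text \<open>By \<open>whittaker_coefficient_rho_sum\<close>, \<open>rho_sum F\<close> kills a nonzero Whittaker vector if and only if
  the row vector \<open>l (rho_sigma_sum F)\<close> vanishes, a condition that does not involve the vector.\<close>
lemma rho_sum_annihilates_whittaker_vector:
  assumes l: "whittaker_covector l" "l \<noteq> 0\<^sub>v d"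
    and w: "whittaker_vector w" and w': "whittaker_vector w'" "w' \<noteq> 0\<^sub>v d"
    and F: "rho_sum F *\<^sub>v w' = 0\<^sub>v d"
  shows "rho_sum F *\<^sub>v w = 0\<^sub>v d"
proof -
  note carrier = whittaker_covector_carrier[OF l(1)] whittaker_vector_carrier[OF w]
    whittaker_vector_carrier[OF w'(1)]
  define l' where "l' = (rho_sigma_sum F)\<^sup>T *\<^sub>v l"
  have l': "l' \<in> carrier_vec d"
    unfolding l'_def by (rule mult_mat_vec_carrier[of _ d d]) (simp_all add: carrier(1))
  have l'_prod: "l' \<bullet> v = l \<bullet> (rho_sigma_sum F *\<^sub>v v)" if "v \<in> carrier_vec d" for v
    unfolding l'_def by (rule transpose_vec_mult_scalar[OF rho_sigma_sum_carrier that carrier(1)])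
  have "l' \<bullet> (rho g *\<^sub>v w') = 0" if "g \<in> G" for g
  proof -
    have "g \<in> sigma ` G" using that sigma_image by simp
    then obtain k where k: "k \<in> G" "g = sigma k" by (rule imageE)
    have "l' \<bullet> (rho g *\<^sub>v w') = l \<bullet> (rho k *\<^sub>v 0\<^sub>v d)"
      using whittaker_coefficient_rho_sum[OF l(1) w'(1) k(1), of F] F that carrier
      by (simp add: k(2) l'_prod)
    also have "rho k *\<^sub>v 0\<^sub>v d = 0\<^sub>v d" using rho_carrier[OF k(1)] by auto
    finally show ?thesis using carrier(1) by simp
  qed
  then have "l' = 0\<^sub>v d"
    using matrix_coefficient_eq_zero[OF l' carrier(3)] w'(2) by blast
  then have "l \<bullet> (rho g *\<^sub>v (rho_sum F *\<^sub>v w)) = 0" if "g \<in> G" for g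
    using that carrier l'_prod[of "rho (sigma g) *\<^sub>v w"]
    by (simp add: whittaker_coefficient_rho_sum[OF l(1) w] sigma_closed)
  then show ?thesis
    using matrix_coefficient_eq_zero[OF carrier(1) rho_sum_vec_carrier[OF carrier(2)]] l(2) by blast
qed

lemma whittaker_vectors_proportional:
  assumes l: "whittaker_covector l" "l \<noteq> 0\<^sub>v d"
    and w1: "whittaker_vector w1" "w1 \<noteq> 0\<^sub>v d" and w2: "whittaker_vector w2"
  obtains c where "w2 = c \<cdot>\<^sub>v w1"
proof -
  note carrier = whittaker_vector_carrier[OF w1(1)] whittaker_vector_carrier[OF w2]
  obtain F c where F: "rho_sum F *\<^sub>v w1 \<noteq> 0\<^sub>v d" "rho_sum F *\<^sub>v w2 = c \<cdot>\<^sub>v (rho_sum F *\<^sub>v w1)"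
    using rho_sum_eigenvector[OF carrier(1) w1(2) carrier(2)] .
  define w where "w = w2 - c \<cdot>\<^sub>v w1"
  have w_carrier: "w \<in> carrier_vec d" using carrier by (simp add: w_def)
  have linear: "M *\<^sub>v w = M *\<^sub>v w2 - c \<cdot>\<^sub>v (M *\<^sub>v w1)" if "M \<in> carrier_mat d d" for M
    using that carrier
    by (simp add: w_def mult_minus_distrib_mat_vec[of _ d d] mult_mat_vec[of _ d d])
  have "whittaker_vector w"
    unfolding whittaker_vector_def
  proof (intro conjI ballI w_carrier)
    fix u assume u: "u \<in> U"
    have "rho u *\<^sub>v w = theta u \<cdot>\<^sub>v w2 - c \<cdot>\<^sub>v (theta u \<cdot>\<^sub>v w1)"
      using u w1 w2 by (simp add: linear subgroupD whittaker_vector_def)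
    also have "\<dots> = theta u \<cdot>\<^sub>v w"
      using carrier by (intro eq_vecI) (auto simp: w_def algebra_simps)
    finally show "rho u *\<^sub>v w = theta u \<cdot>\<^sub>v w" .
  qed
  moreover have "rho_sum F *\<^sub>v w = 0\<^sub>v d"
    using carrier(1) by (simp add: linear F(2))
  ultimately have "w = 0\<^sub>v d"
    using rho_sum_annihilates_whittaker_vector[OF l w1(1)] F(1) by blast
  have "w2 $ i = (c \<cdot>\<^sub>v w1) $ i" if i: "i < d" for i
  proof -
    have "w $ i = w2 $ i - (c \<cdot>\<^sub>v w1) $ i" using i carrier by (simp add: w_def)
    then show ?thesis using \<open>w = 0\<^sub>v d\<close> i by simp
  qed
  then show thesis using carrier by (intro that[of c] eq_vecI) auto
qed

definition whittaker_projection :: "complex mat" where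
  "whittaker_projection = rho_sum (\<lambda>u. if u \<in> U then inverse (theta u) else 0)"

lemma whittaker_vector_projection:
  assumes v: "v \<in> carrier_vec d"
  shows "whittaker_vector (whittaker_projection *\<^sub>v v)"
  unfolding whittaker_vector_def
proof (intro conjI ballI)
  let ?F = "\<lambda>u. if u \<in> U then inverse (theta u) else 0"
  fix u assume u: "u \<in> U"
  obtain u' where u': "u' \<in> U" "u * u' = 1\<^sub>m n" "u' * u = 1\<^sub>m n"
    using U.inverse_closed[OF u] by auto
  have "?F (u' * k) = theta u * ?F k" if k: "k \<in> G" for k
  proof (cases "k \<in> U")
    case True
    have "theta k = theta u * theta (u' * k)"
      using left_inverse_mult_cancel[of u n u' k n] u u' True U.carrierD
      by (simp add: theta_mult[symmetric] U.mult_closed)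
    then show ?thesis using True u u' theta_nonzero[OF u] by (simp add: U.mult_closed)
  next
    case False
    then show ?thesis using U.mult_left_mem_iff[OF u'(1)] G.carrierD[OF k] by simp
  qed
  then have "rho_sum (\<lambda>k. ?F (u' * k)) *\<^sub>v v = theta u \<cdot>\<^sub>v (rho_sum ?F *\<^sub>v v)"
    using v by (intro eq_vec_scalar_prodI[of _ d])
      (simp_all add: scalar_prod_rho_sum sum_distrib_left mult.assoc del: if_cong)
  then show "rho u *\<^sub>v (whittaker_projection *\<^sub>v v) = theta u \<cdot>\<^sub>v (whittaker_projection *\<^sub>v v)"
    unfolding whittaker_projection_def
    by (simp only: rho_rho_sum_translate[OF subgroupD[OF u] subgroupD[OF u'(1)] u'(3) v])
qed (use v in \<open>simp add: whittaker_projection_def\<close>)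

lemma scalar_prod_whittaker_projection:
  assumes l: "whittaker_covector l" and v: "v \<in> carrier_vec d"
  shows "l \<bullet> (whittaker_projection *\<^sub>v v) = of_nat (card U) * (l \<bullet> v)"
proof -
  have "l \<bullet> (whittaker_projection *\<^sub>v v)
      = (\<Sum>u\<in>G. if u \<in> U then inverse (theta u) * (l \<bullet> (rho u *\<^sub>v v)) else 0)"
    unfolding whittaker_projection_def scalar_prod_rho_sum[OF whittaker_covector_carrier[OF l] v]
    by (intro sum.cong) auto
  also have "\<dots> = (\<Sum>u\<in>U. inverse (theta u) * (l \<bullet> (rho u *\<^sub>v v)))"
    using finite_group subgroup by (simp add: sum.inter_restrict[symmetric] Int_absorb1)
  also have "\<dots> = (\<Sum>u\<in>U. l \<bullet> v)"
    using l v theta_nonzero by (intro sum.cong refl) (simp add: whittaker_covector_def)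
  finally show ?thesis by simp
qed

lemma whittaker_covectors_dependent:
  assumes l: "whittaker_covector l1" "whittaker_covector l2"
  obtains c1 c2 where "c1 \<noteq> 0 \<or> c2 \<noteq> 0"
    "\<And>v. v \<in> carrier_vec d \<Longrightarrow> c1 * (l1 \<bullet> v) + c2 * (l2 \<bullet> v) = 0"
proof (cases "l1 = 0\<^sub>v d")
  case True
  then show thesis using that[of 1 0] by simp
next
  case False
  note carrier = whittaker_covector_carrier[OF l(1)] whittaker_covector_carrier[OF l(2)]
  let ?P = whittaker_projection
  obtain v0 where v0: "v0 \<in> carrier_vec d" "l1 \<bullet> v0 \<noteq> 0"
    using eq_zero_vecI_scalar_prod[OF carrier(1)] False by blast
  have card: "card U \<noteq> 0"
    using finite_subset[OF subgroup finite_group] U.one_closed by auto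
  note projection = whittaker_vector_projection scalar_prod_whittaker_projection[OF l(1)]
    scalar_prod_whittaker_projection[OF l(2)]
  have nonzero: "l1 \<bullet> (?P *\<^sub>v v0) \<noteq> 0" using projection(2)[OF v0(1)] v0(2) card by simp
  then have "?P *\<^sub>v v0 \<noteq> 0\<^sub>v d" using carrier(1) by auto
  note proportional = whittaker_vectors_proportional[OF l(1) False projection(1)[OF v0(1)] this]
  have "(l2 \<bullet> (?P *\<^sub>v v0)) * (l1 \<bullet> v) + (- (l1 \<bullet> (?P *\<^sub>v v0))) * (l2 \<bullet> v) = 0"
    if v: "v \<in> carrier_vec d" for v
  proof -
    obtain c where c: "?P *\<^sub>v v = c \<cdot>\<^sub>v (?P *\<^sub>v v0)"
      using proportional[OF projection(1)[OF v]] .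
    have "of_nat (card U) * (l \<bullet> v) = c * (l \<bullet> (?P *\<^sub>v v0))" if "l = l1 \<or> l = l2" for l
      using projection(2,3)[OF v] that carrier whittaker_vector_carrier[OF projection(1)[OF v0(1)]]
      by (auto simp: c)
    then have
      "of_nat (card U) * ((l2 \<bullet> (?P *\<^sub>v v0)) * (l1 \<bullet> v) - (l1 \<bullet> (?P *\<^sub>v v0)) * (l2 \<bullet> v)) = 0"
      by (simp add: right_diff_distrib mult.left_commute[of "of_nat (card U)"])
    then show ?thesis using card by simp
  qed
  then show thesis using that[of "l2 \<bullet> (?P *\<^sub>v v0)" "- (l1 \<bullet> (?P *\<^sub>v v0))"] nonzero by simp
qed

lemma intertwiner_whittaker_covector:
  assumes T: "intertwiner G U theta d rho T"
  obtains l where "whittaker_covector l"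
    "\<And>v g. v \<in> carrier_vec d \<Longrightarrow> g \<in> G \<Longrightarrow> T v g = l \<bullet> (rho g *\<^sub>v v)"
proof -
  obtain l where l: "l \<in> carrier_vec d" "\<And>v. v \<in> carrier_vec d \<Longrightarrow> T v (1\<^sub>m n) = l \<bullet> v"
    by (rule linear_functional_eq_scalar_prod[of d "\<lambda>v. T v (1\<^sub>m n)"])
      (use T in \<open>simp_all add: intertwiner_def\<close>)
  have eval: "T v g = l \<bullet> (rho g *\<^sub>v v)" if "v \<in> carrier_vec d" "g \<in> G" for v g
    using T that l(2)[of "rho g *\<^sub>v v"] G.one_closed G.carrierD[OF that(2)]
    by (simp add: intertwiner_def ind_action_def)
  have equivariant: "T v (u * 1\<^sub>m n) = theta u * T v (1\<^sub>m n)" if "v \<in> carrier_vec d" "u \<in> U" for v u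
    using T that G.one_closed unfolding intertwiner_def ind_space_def by blast
  have "l \<bullet> (rho u *\<^sub>v v) = theta u * (l \<bullet> v)" if "u \<in> U" "v \<in> carrier_vec d" for u v
    using that equivariant[OF that(2,1)] eval[of v u] l(2) U.carrierD[of u] subgroupD by simp
  then have "whittaker_covector l" using l(1) by (simp add: whittaker_covector_def)
  then show thesis using eval by (rule that)
qed

theorem multiplicity_one: "hom_dim_le_1 G U theta d rho"
  unfolding hom_dim_le_1_def
proof (intro allI impI, elim conjE)
  fix T1 T2
  assume T: "intertwiner G U theta d rho T1" "intertwiner G U theta d rho T2"
  obtain l1 where l1: "whittaker_covector l1"
    "\<And>v g. v \<in> carrier_vec d \<Longrightarrow> g \<in> G \<Longrightarrow> T1 v g = l1 \<bullet> (rho g *\<^sub>v v)"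
    using intertwiner_whittaker_covector[OF T(1)] by blast
  obtain l2 where l2: "whittaker_covector l2"
    "\<And>v g. v \<in> carrier_vec d \<Longrightarrow> g \<in> G \<Longrightarrow> T2 v g = l2 \<bullet> (rho g *\<^sub>v v)"
    using intertwiner_whittaker_covector[OF T(2)] by blast
  obtain c1 c2 where c: "c1 \<noteq> 0 \<or> c2 \<noteq> 0"
    "\<And>v. v \<in> carrier_vec d \<Longrightarrow> c1 * (l1 \<bullet> v) + c2 * (l2 \<bullet> v) = 0"
    using whittaker_covectors_dependent[OF l1(1) l2(1)] by blast
  have "c1 * T1 v g + c2 * T2 v g = 0" if v: "v \<in> carrier_vec d" for v g
  proof (cases "g \<in> G")
    case True
    then show ?thesis using l1(2)[OF v] l2(2)[OF v] c(2)[of "rho g *\<^sub>v v"] v by simp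
  next
    case False
    then have "T1 v g = 0" "T2 v g = 0"
      using T v by (auto simp: intertwiner_def ind_space_def)
    then show ?thesis by simp
  qed
  then show "\<exists>c1 c2. (c1 \<noteq> 0 \<or> c2 \<noteq> 0) \<and> (\<forall>v\<in>carrier_vec d. \<forall>g. c1 * T1 v g + c2 * T2 v g = 0)"
    using c(1) by blast
qed

end

section \<open>Unipotent upper triangular matrices\<close>

lemma unit_det_obtain_inverse:
  fixes A :: "'r::comm_ring_1 mat"
  assumes A: "A \<in> carrier_mat n n" and e: "det A * e = 1"
  obtains B where "B \<in> carrier_mat n n" "A * B = 1\<^sub>m n" "B * A = 1\<^sub>m n"
proof
  note adj = adj_mat[OF A]
  have "e \<cdot>\<^sub>m (det A \<cdot>\<^sub>m 1\<^sub>m n) = 1\<^sub>m n"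
    using e by (intro eq_matI) (auto simp: mult.assoc[symmetric] mult.commute)
  then show "A * (e \<cdot>\<^sub>m adj_mat A) = 1\<^sub>m n" "e \<cdot>\<^sub>m adj_mat A * A = 1\<^sub>m n"
    using mult_smult_distrib[OF A adj(1)] mult_smult_assoc_mat[OF adj(1) A] adj(2,3) by simp_all
qed (use adj_mat(1)[OF A] in simp)

lemma index_mult_upper_triangular:
  fixes A B :: "'r::comm_ring_1 mat"
  assumes A: "A \<in> carrier_mat n n" "upper_triangular A"
    and B: "B \<in> carrier_mat n n" "upper_triangular B" and ij: "i < n" "j < n"
  shows "(A * B) $$ (i, j) = (\<Sum>l = i..j. A $$ (i, l) * B $$ (l, j))"
  unfolding index_mult_mat_sum[OF A(1) B(1) ij]
proof (rule sum.mono_neutral_right)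
  show "\<forall>l\<in>{..<n} - {i..j}. A $$ (i, l) * B $$ (l, j) = 0"
  proof
    fix l assume l: "l \<in> {..<n} - {i..j}"
    then consider "l < i" | "j < l" by fastforce
    then show "A $$ (i, l) * B $$ (l, j) = 0"
      using l ij A B upper_triangularD[of A l i] upper_triangularD[of B j l] by cases auto
  qed
qed (use ij in auto)

lemma UTn_iff:
  "u \<in> UTn n \<longleftrightarrow> u \<in> carrier_mat n n \<and> upper_triangular u \<and> (\<forall>i<n. u $$ (i, i) = 1)"
  by (auto simp: UTn_def upper_triangular_def)

lemma UTn_carrier: "u \<in> UTn n \<Longrightarrow> u \<in> carrier_mat n n"
  and UTn_upper_triangular: "u \<in> UTn n \<Longrightarrow> upper_triangular u"
  and UTn_diag: "u \<in> UTn n \<Longrightarrow> i < n \<Longrightarrow> u $$ (i, i) = 1"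
  by (auto simp: UTn_iff)

lemma UTn_mult:
  assumes u: "u \<in> UTn n" and v: "v \<in> UTn n"
  shows "u * v \<in> UTn n"
proof -
  note index = index_mult_upper_triangular[OF UTn_carrier UTn_upper_triangular UTn_carrier
      UTn_upper_triangular, OF u u v v]
  have "upper_triangular (u * v)"
    using UTn_carrier[OF u] by (intro upper_triangularI) (simp add: index del: index_mult_mat(1))
  then show ?thesis
    using u v UTn_carrier by (auto simp: UTn_iff index simp del: index_mult_mat(1))
qed

lemma UTn_mult_superdiag:
  assumes u: "u \<in> UTn n" and v: "v \<in> UTn n" and i: "Suc i < n"
  shows "(u * v) $$ (i, Suc i) = u $$ (i, Suc i) + v $$ (i, Suc i)"
  using i UTn_diag[OF u] UTn_diag[OF v]
  by (subst index_mult_upper_triangular[OF UTn_carrier UTn_upper_triangular UTn_carrier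
        UTn_upper_triangular, OF u u v v]) auto

lemma UTn_det: "u \<in> UTn n \<Longrightarrow> det u = 1"
  using det_upper_triangular[of u n] by (auto simp: UTn_iff prod_list_diag_prod)

lemma UTn_right_inverse:
  assumes u: "u \<in> UTn n" and v: "v \<in> carrier_mat n n" "u * v = 1\<^sub>m n"
  shows "v \<in> UTn n"
proof -
  have index: "v $$ (i, j) = (if i = j then 1 else 0)" if "i < n" "j \<le> i" for i j
    using that
  proof (induction "n - i" arbitrary: i rule: less_induct)
    case less
    have "v $$ (i, j) = (\<Sum>l<n. if l = i then u $$ (i, i) * v $$ (i, j) else 0)"
      using less.prems UTn_diag[OF u] by simp
    also have "\<dots> = (\<Sum>l<n. u $$ (i, l) * v $$ (l, j))"
    proof (intro sum.cong refl)
      fix l assume l: "l \<in> {..<n}"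
      show "(if l = i then u $$ (i, i) * v $$ (i, j) else 0) = u $$ (i, l) * v $$ (l, j)"
        using l less.prems less.hyps[of l] upper_triangularD[OF UTn_upper_triangular[OF u], of l i]
          UTn_carrier[OF u] by (cases l i rule: linorder_cases) auto
    qed
    also have "\<dots> = (u * v) $$ (i, j)"
      using less.prems by (intro index_mult_mat_sum[OF UTn_carrier[OF u] v(1), symmetric]) auto
    finally show ?case using v(2) less.prems by simp
  qed
  show ?thesis using v(1) index by (auto simp: UTn_iff intro!: upper_triangularI)
qed

lemma mat_group_UTn: "mat_group n (UTn n :: 'r::comm_ring_1 mat set)"
proof
  fix u :: "'r mat" assume u: "u \<in> UTn n"
  obtain v where v: "v \<in> carrier_mat n n" "u * v = 1\<^sub>m n" "v * u = 1\<^sub>m n"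
    using unit_det_obtain_inverse[OF UTn_carrier[OF u], of 1] UTn_det[OF u] by auto
  then show "\<exists>v\<in>UTn n. u * v = 1\<^sub>m n \<and> v * u = 1\<^sub>m n"
    using UTn_right_inverse[OF u] by blast
qed (auto simp: UTn_mult, auto simp: UTn_iff)

section \<open>Hessenberg matrices and Krylov bases\<close>

lemma pow_mat_intertwine:
  assumes A: "A \<in> carrier_mat m m" and B: "B \<in> carrier_mat n n" and g: "g \<in> carrier_mat m n"
    and eq: "A * g = g * B"
  shows "A ^\<^sub>m k * g = g * B ^\<^sub>m k"
proof (induction k)
  case 0
  then show ?case using A B g by simp
next
  case (Suc k)
  have Ak: "A ^\<^sub>m k \<in> carrier_mat m m" and Bk: "B ^\<^sub>m k \<in> carrier_mat n n" using A B by simp_all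
  have "A ^\<^sub>m Suc k * g = A ^\<^sub>m k * (A * g)" using assoc_mult_mat[OF Ak A g] by simp
  also have "\<dots> = A ^\<^sub>m k * g * B" using assoc_mult_mat[OF Ak g B] eq by simp
  also have "\<dots> = g * (B ^\<^sub>m k * B)" using assoc_mult_mat[OF g Bk B] Suc by simp
  finally show ?case by simp
qed

lemma intertwine_mult:
  fixes A :: "'r::comm_ring_1 mat"
  assumes "A \<in> carrier_mat m m" "B \<in> carrier_mat n n" "g \<in> carrier_mat m n" "X \<in> carrier_mat n k"
    and "A * g = g * B"
  shows "A * (g * X) = g * (B * X)"
  using assms assoc_mult_mat[of A m m g n X k] assoc_mult_mat[of g m n B n X k] by simp

lemma mult_pow_mat: "A \<in> carrier_mat n n \<Longrightarrow> A * A ^\<^sub>m k = A ^\<^sub>m Suc k"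
  using pow_mat_intertwine[of A n A n A k] by simp

definition mat_poly :: "nat \<Rightarrow> (nat \<Rightarrow> 'r::comm_ring_1) \<Rightarrow> 'r mat \<Rightarrow> 'r mat" where
  "mat_poly n c A = mat_lincomb n n {..<n} c (\<lambda>k. A ^\<^sub>m k)"

lemma mat_poly_carrier [simp]: "mat_poly n c A \<in> carrier_mat n n"
  by (simp add: mat_poly_def)

lemma mat_poly_intertwine:
  assumes "A \<in> carrier_mat n n" "B \<in> carrier_mat n n" "g \<in> carrier_mat n n" "A * g = g * B"
  shows "mat_poly n c A * g = g * mat_poly n c B"
  unfolding mat_poly_def using assms
  by (simp add: mat_lincomb_mult mult_mat_lincomb[of _ n n] pow_mat_intertwine[OF assms])

definition subdiagonal_mat :: "nat \<Rightarrow> (nat \<Rightarrow> 'r::comm_ring_1) \<Rightarrow> 'r mat" where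
  "subdiagonal_mat n a = mat n n (\<lambda>(i, j). if i = Suc j then a j else 0)"

lemma subdiagonal_mat_carrier [simp]: "subdiagonal_mat n a \<in> carrier_mat n n"
  by (simp add: subdiagonal_mat_def)

definition hessenberg :: "nat \<Rightarrow> (nat \<Rightarrow> 'r::comm_ring_1) \<Rightarrow> 'r mat \<Rightarrow> bool" where
  "hessenberg n a A \<longleftrightarrow> A \<in> carrier_mat n n \<and> upper_triangular (A - subdiagonal_mat n a)"

lemma hessenberg_carrier: "hessenberg n a A \<Longrightarrow> A \<in> carrier_mat n n"
  by (simp add: hessenberg_def)

lemma hessenberg_lower:
  assumes "hessenberg n a A" "j < i" "i < n"
  shows "A $$ (i, j) = (if i = Suc j then a j else 0)"
  using assms upper_triangularD[of "A - subdiagonal_mat n a" j i]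
  by (auto simp: hessenberg_def subdiagonal_mat_def)

definition krylov :: "nat \<Rightarrow> 'r::comm_ring_1 mat \<Rightarrow> 'r mat" where
  "krylov n A = mat n n (\<lambda>(i, k). (A ^\<^sub>m k) $$ (i, 0))"

lemma krylov_carrier [simp]: "krylov n A \<in> carrier_mat n n"
  by (simp add: krylov_def)

lemma dim_krylov [simp]: "dim_row (krylov n A) = n" "dim_col (krylov n A) = n"
  by (simp_all add: krylov_def)

lemma col_krylov: "A \<in> carrier_mat n n \<Longrightarrow> k < n \<Longrightarrow> col (krylov n A) k = col (A ^\<^sub>m k) 0"
  by (intro eq_vecI) (auto simp: krylov_def)

lemma col_mat_poly:
  assumes "A \<in> carrier_mat n n" "0 < n"
  shows "col (mat_poly n c A) 0 = krylov n A *\<^sub>v vec n c"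
  using assms
  by (intro eq_vecI) (auto simp: mat_poly_def krylov_def scalar_prod_def atLeast0LessThan
      mult.commute)

lemma hessenberg_pow_first_col:
  assumes A: "hessenberg n a A" and "k \<le> i" "i < n"
  shows "(A ^\<^sub>m k) $$ (i, 0) = (if i = k then \<Prod>j<k. a j else 0)"
  using assms(2,3)
proof (induction k arbitrary: i)
  case 0
  then show ?case using hessenberg_carrier[OF A] by auto
next
  case (Suc k)
  note Ac = hessenberg_carrier[OF A]
  obtain i' where i': "i = Suc i'" using Suc.prems by (cases i) auto
  have "(A ^\<^sub>m Suc k) $$ (i, 0) = (\<Sum>l<n. A $$ (i, l) * (A ^\<^sub>m k) $$ (l, 0))"
    unfolding mult_pow_mat[OF Ac, symmetric]
    using Suc.prems Ac by (intro index_mult_mat_sum[of _ n n _ n]) auto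
  also have "\<dots> = (\<Sum>l<n. if l = i' then a i' * (A ^\<^sub>m k) $$ (i', 0) else 0)"
  proof (intro sum.cong refl)
    fix l assume l: "l \<in> {..<n}"
    consider "l < i'" | "l = i'" | "i \<le> l" using i' by linarith
    then show "A $$ (i, l) * (A ^\<^sub>m k) $$ (l, 0)
        = (if l = i' then a i' * (A ^\<^sub>m k) $$ (i', 0) else 0)"
      using l i' Suc.prems Suc.IH[of l] hessenberg_lower[OF A, of l i] by cases auto
  qed
  also have "\<dots> = (if i = Suc k then \<Prod>j<Suc k. a j else 0)"
    using Suc.prems i' Suc.IH[of i'] by (simp add: mult.commute)
  finally show ?case .
qed

definition companion_mat :: "nat \<Rightarrow> (nat \<Rightarrow> 'r::comm_ring_1) \<Rightarrow> 'r mat" where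
  "companion_mat n c = mat n n (\<lambda>(j, k). if Suc k = n then c j else if j = Suc k then 1 else 0)"

lemma companion_mat_carrier [simp]: "companion_mat n c \<in> carrier_mat n n"
  by (simp add: companion_mat_def)

lemma krylov_companion:
  assumes A: "A \<in> carrier_mat n n" and c: "A ^\<^sub>m n = mat_poly n c A"
  shows "A * krylov n A = krylov n A * companion_mat n c"
proof (rule mat_col_eqI)
  fix k assume "k < dim_col (krylov n A * companion_mat n c)"
  then have k: "k < n" by (simp add: companion_mat_def)
  have "col (A * krylov n A) k = A *\<^sub>v col (A ^\<^sub>m k) 0"
    using k by (simp add: col_mult2[OF A krylov_carrier] col_krylov[OF A])
  also have "\<dots> = col (A ^\<^sub>m Suc k) 0"
    using A k unfolding mult_pow_mat[OF A, symmetric]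
    by (intro col_mult2[symmetric, of _ n n _ n]) auto
  also have "\<dots> = krylov n A *\<^sub>v col (companion_mat n c) k"
  proof (cases "Suc k = n")
    case True
    then have "col (companion_mat n c) k = vec n c" by (auto simp: companion_mat_def)
    moreover have "col (A ^\<^sub>m Suc k) 0 = krylov n A *\<^sub>v vec n c"
      using k c col_mat_poly[OF A] True by simp
    ultimately show ?thesis by simp
  next
    case False
    then have "col (companion_mat n c) k = unit_vec n (Suc k)"
      using k by (auto simp: companion_mat_def)
    then have "krylov n A *\<^sub>v col (companion_mat n c) k = col (krylov n A) (Suc k)"
      using k False by (intro eq_vecI) simp_all
    then show ?thesis using k False by (simp add: col_krylov[OF A])
  qed
  also have "\<dots> = col (krylov n A * companion_mat n c) k"
    using k by (intro col_mult2[symmetric, of _ n n _ n]) simp_all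
  finally show "col (A * krylov n A) k = col (krylov n A * companion_mat n c) k" .
qed (use A in \<open>simp_all add: companion_mat_def\<close>)

context
  fixes n :: nat and a b :: "nat \<Rightarrow> 'r::comm_ring_1"
  assumes units: "\<And>i. a i * b i = 1"
begin

lemma prod_units: "(\<Prod>j<i. a j) * (\<Prod>j<i. b j) = 1"
  by (simp add: prod.distrib[symmetric] units)

lemma mat_diag_prod_units:
  "mat_diag n (\<lambda>i. \<Prod>j<i. b j) * mat_diag n (\<lambda>i. \<Prod>j<i. a j) = 1\<^sub>m n"
  by (simp add: prod_units mult.commute)

lemma krylov_normalized_UTn:
  assumes A: "hessenberg n a A"
  shows "krylov n A * mat_diag n (\<lambda>i. \<Prod>j<i. b j) \<in> UTn n"
  unfolding mat_diag_mult_right[OF krylov_carrier]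
  by (auto simp: UTn_iff krylov_def hessenberg_pow_first_col[OF A] prod_units
      intro!: upper_triangularI)

lemma krylov_right_inverse:
  assumes A: "hessenberg n a A"
  obtains M where "M \<in> carrier_mat n n" "krylov n A * M = 1\<^sub>m n"
proof -
  interpret UTn: mat_group n "UTn n :: 'r mat set" by (rule mat_group_UTn)
  let ?D = "mat_diag n (\<lambda>i. \<Prod>j<i. b j)"
  obtain V where V: "V \<in> UTn n" "krylov n A * ?D * V = 1\<^sub>m n"
    using UTn.inverse_closed[OF krylov_normalized_UTn[OF A]] by blast
  then have "krylov n A * (?D * V) = 1\<^sub>m n"
    using assoc_mult_mat[OF krylov_carrier mat_diag_dim UTn_carrier[OF V(1)]] by simp
  then show thesis
    using that mult_carrier_mat[OF mat_diag_dim UTn_carrier[OF V(1)]] by blast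
qed

lemma commuting_eqI_first_col:
  assumes A: "hessenberg n a A"
    and X: "X \<in> carrier_mat n n" "A * X = X * A" and Y: "Y \<in> carrier_mat n n" "A * Y = Y * A"
    and col: "col X 0 = col Y 0"
  shows "X = Y"
proof -
  note Ac = hessenberg_carrier[OF A]
  have Ak: "A ^\<^sub>m k \<in> carrier_mat n n" for k using Ac by simp
  have krylov_col: "col (Z * krylov n A) k = A ^\<^sub>m k *\<^sub>v col Z 0"
    if Z: "Z \<in> carrier_mat n n" "A * Z = Z * A" and k: "k < n" for Z k
  proof -
    have "col (Z * krylov n A) k = col (Z * A ^\<^sub>m k) 0"
      using k
      by (simp add: col_mult2[OF Z(1) krylov_carrier] col_mult2[OF Z(1) Ak] col_krylov[OF Ac])
    also have "Z * A ^\<^sub>m k = A ^\<^sub>m k * Z" by (rule pow_mat_intertwine[OF Ac Ac Z, symmetric])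
    finally show ?thesis using k by (simp add: col_mult2[OF Ak Z(1)])
  qed
  have XY: "X * krylov n A = Y * krylov n A"
    by (rule mat_col_eqI) (use X Y in \<open>simp_all add: krylov_col col del: col_mult2\<close>)
  obtain M where M: "M \<in> carrier_mat n n" "krylov n A * M = 1\<^sub>m n"
    by (rule krylov_right_inverse[OF A])
  have "X = X * krylov n A * M" "Y = Y * krylov n A * M"
    using X Y M by (simp_all add: assoc_mult_mat[OF _ krylov_carrier M(1), of _ n])
  then show ?thesis by (simp add: XY)
qed

lemma hessenberg_centralizer:
  assumes A: "hessenberg n a A" and Z: "Z \<in> carrier_mat n n" "A * Z = Z * A"
  obtains c where "Z = mat_poly n c A"
proof -
  note Ac = hessenberg_carrier[OF A]
  obtain M where M: "M \<in> carrier_mat n n" "krylov n A * M = 1\<^sub>m n"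
    by (rule krylov_right_inverse[OF A])
  define v where "v = M *\<^sub>v col Z 0"
  have "Z = mat_poly n (($) v) A"
  proof (cases "n = 0")
    case True
    then show ?thesis using Z(1) by (intro eq_matI) (auto simp: mat_poly_def)
  next
    case False
    then have v: "v \<in> carrier_vec n" using M(1) Z(1) by (auto simp: v_def)
    have "krylov n A *\<^sub>v v = col Z 0"
      unfolding v_def using False M Z(1)
      by (simp add: assoc_mult_mat_vec[OF krylov_carrier M(1), symmetric, of "col Z 0"])
    also have "v = vec n (($) v)" using v by auto
    finally have "col (mat_poly n (($) v) A) 0 = col Z 0"
      using col_mat_poly[OF Ac] False by simp
    then show ?thesis
      using commuting_eqI_first_col[OF A Z mat_poly_carrier
          mat_poly_intertwine[OF Ac Ac Ac refl, symmetric]]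
      by simp
  qed
  then show thesis by (rule that)
qed

lemma hessenberg_monic_relation:
  assumes A: "hessenberg n a A"
  obtains c where "A ^\<^sub>m n = mat_poly n c A"
  using hessenberg_centralizer[OF A, of "A ^\<^sub>m n"] hessenberg_carrier[OF A]
  by (auto simp: mult_pow_mat[symmetric] simp flip: pow_mat.simps(2))

lemma hessenberg_unipotent_conjugate_companion:
  assumes A: "hessenberg n a A" and c: "A ^\<^sub>m n = mat_poly n c A"
  obtains V where "V \<in> UTn n"
    "A * V = V * (mat_diag n (\<lambda>i. \<Prod>j<i. a j) * companion_mat n c * mat_diag n (\<lambda>i. \<Prod>j<i. b j))"
proof -
  let ?K = "krylov n A" and ?C = "companion_mat n c"
  let ?D = "mat_diag n (\<lambda>i. \<Prod>j<i. a j)" and ?E = "mat_diag n (\<lambda>i. \<Prod>j<i. b j)"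
  note Ac = hessenberg_carrier[OF A]
  note assoc = assoc_mult_mat[of _ n n _ n _ n] mult_carrier_mat[of _ n n _ n]
  have "A * (?K * ?E) = (A * ?K) * ?E" using Ac by (simp add: assoc)
  also have "\<dots> = (?K * ?C) * ?E" by (simp add: krylov_companion[OF Ac c])
  also have "\<dots> = ?K * (?E * (?D * (?C * ?E)))"
    by (simp add: assoc
        left_inverse_mult_cancel[OF mat_diag_dim mat_diag_dim mat_diag_prod_units, of _ n]
        del: mat_diag_diag)
  also have "\<dots> = ?K * ?E * (?D * ?C * ?E)" by (simp add: assoc del: mat_diag_diag)
  finally show thesis by (rule that[OF krylov_normalized_UTn[OF A]])
qed

lemma hessenberg_conjugate:
  assumes A: "hessenberg n a A" and B: "hessenberg n a B"
    and cA: "A ^\<^sub>m n = mat_poly n c A" and cB: "B ^\<^sub>m n = mat_poly n c B"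
  obtains u where "u \<in> UTn n" "A * u = u * B"
proof -
  interpret UTn: mat_group n "UTn n :: 'r mat set" by (rule mat_group_UTn)
  define C where
    "C = mat_diag n (\<lambda>i. \<Prod>j<i. a j) * companion_mat n c * mat_diag n (\<lambda>i. \<Prod>j<i. b j)"
  obtain V where V: "V \<in> UTn n" "A * V = V * C"
    unfolding C_def by (rule hessenberg_unipotent_conjugate_companion[OF A cA])
  obtain W where W: "W \<in> UTn n" "B * W = W * C"
    unfolding C_def by (rule hessenberg_unipotent_conjugate_companion[OF B cB])
  obtain W' where W': "W' \<in> UTn n" "W * W' = 1\<^sub>m n" "W' * W = 1\<^sub>m n"
    using UTn.inverse_closed[OF W(1)] by auto
  have carrier: "A \<in> carrier_mat n n" "B \<in> carrier_mat n n" "V \<in> carrier_mat n n"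
    "W \<in> carrier_mat n n" "W' \<in> carrier_mat n n" "C \<in> carrier_mat n n"
    using A B V W W'
    by (auto simp: UTn_carrier hessenberg_carrier C_def intro!: mult_carrier_mat[of _ n n])
  note assoc = assoc_mult_mat[of _ n n _ n _ n] mult_carrier_mat[of _ n n _ n]
  have "C * W' = W' * (W * (C * W'))"
    using carrier by (simp add: left_inverse_mult_cancel[OF _ _ W'(3), of _ n] assoc)
  also have "\<dots> = W' * (B * (W * W'))"
    using intertwine_mult[OF carrier(2,6,4,5) W(2)] by simp
  finally have "C * W' = W' * B" using carrier W'(2) by simp
  then have "A * (V * W') = V * W' * B"
    using carrier intertwine_mult[OF carrier(1,6,3,5) V(2)] by (simp add: assoc)
  then show thesis by (rule that[OF UTn_mult[OF V(1) W'(1)]])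
qed

lemma hessenberg_intertwiner_factor:
  assumes A: "hessenberg n a A" and B: "hessenberg n a B"
    and g: "g \<in> carrier_mat n n" "A * g = g * B" and h: "h \<in> carrier_mat n n" "h * g = 1\<^sub>m n"
  obtains u c where "u \<in> UTn n" "g = u * mat_poly n c B"
proof -
  interpret UTn: mat_group n "UTn n :: 'r mat set" by (rule mat_group_UTn)
  note Ac = hessenberg_carrier[OF A] and Bc = hessenberg_carrier[OF B]
  obtain c where c: "A ^\<^sub>m n = mat_poly n c A" by (rule hessenberg_monic_relation[OF A])
  have "g * B ^\<^sub>m n = g * mat_poly n c B"
    using pow_mat_intertwine[OF Ac Bc g, of n] mat_poly_intertwine[OF Ac Bc g, of c] c by simp
  then have "h * (g * B ^\<^sub>m n) = h * (g * mat_poly n c B)" by simp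
  then have cB: "B ^\<^sub>m n = mat_poly n c B"
    using Bc by (simp add: left_inverse_mult_cancel[OF h(1) g(1) h(2), of _ n])
  obtain u where u: "u \<in> UTn n" "A * u = u * B" by (rule hessenberg_conjugate[OF A B c cB])
  obtain u' where u': "u' \<in> UTn n" "u * u' = 1\<^sub>m n" "u' * u = 1\<^sub>m n"
    using UTn.inverse_closed[OF u(1)] by auto
  note uc = UTn_carrier[OF u(1)] UTn_carrier[OF u'(1)]
  have guz: "u * (u' * g) = g" by (rule left_inverse_mult_cancel[OF uc u'(2) g(1)])
  have z: "u' * g \<in> carrier_mat n n" by (rule mult_carrier_mat[OF uc(2) g(1)])
  have "B * (u' * g) = u' * (u * (B * (u' * g)))"
    by (rule left_inverse_mult_cancel[OF uc(2,1) u'(3) mult_carrier_mat[OF Bc z], symmetric])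
  also have "\<dots> = u' * (A * g)" by (simp add: intertwine_mult[OF Ac Bc uc(1) z u(2), symmetric] guz)
  also have "\<dots> = u' * g * B" using assoc_mult_mat[OF uc(2) g(1) Bc] g(2) by simp
  finally obtain c' where "u' * g = mat_poly n c' B" by (rule hessenberg_centralizer[OF B z])
  then have "g = u * mat_poly n c' B" using guz by simp
  with u(1) show thesis by (rule that)
qed

end

section \<open>Trace and twisted transposition\<close>

definition mat_trace :: "'r::comm_ring_1 mat \<Rightarrow> 'r" where
  "mat_trace A = (\<Sum>i<dim_row A. A $$ (i, i))"

lemma mat_trace_mult:
  assumes "A \<in> carrier_mat n m" "B \<in> carrier_mat m n"
  shows "mat_trace (A * B) = (\<Sum>i<n. \<Sum>j<m. A $$ (i, j) * B $$ (j, i))"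
  using assms by (simp add: mat_trace_def index_mult_mat_sum[OF assms] del: index_mult_mat(1))

lemma mat_trace_commute:
  assumes "A \<in> carrier_mat n m" "B \<in> carrier_mat m n"
  shows "mat_trace (A * B) = mat_trace (B * A)"
  unfolding mat_trace_mult[OF assms] mat_trace_mult[OF assms(2,1)]
  by (subst sum.swap) (simp add: mult.commute)

lemma mat_trace_add:
  "A \<in> carrier_mat n n \<Longrightarrow> B \<in> carrier_mat n n \<Longrightarrow> mat_trace (A + B) = mat_trace A + mat_trace B"
  by (simp add: mat_trace_def sum.distrib)

lemma mat_trace_minus:
  "A \<in> carrier_mat n n \<Longrightarrow> B \<in> carrier_mat n n \<Longrightarrow> mat_trace (A - B) = mat_trace A - mat_trace B"
  by (simp add: mat_trace_def sum_subtractf)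

lemma mat_trace_transpose: "A \<in> carrier_mat n n \<Longrightarrow> mat_trace A\<^sup>T = mat_trace A"
  by (simp add: mat_trace_def)

definition twisted_transpose :: "'r::comm_ring_1 mat \<Rightarrow> 'r mat \<Rightarrow> 'r mat \<Rightarrow> 'r mat" where
  "twisted_transpose P Q X = P * X\<^sup>T * Q"

context
  fixes n :: nat and P Q :: "'r::comm_ring_1 mat"
  assumes P: "P \<in> carrier_mat n n" and Q: "Q \<in> carrier_mat n n"
    and PQ: "P * Q = 1\<^sub>m n" and QP: "Q * P = 1\<^sub>m n"
begin

lemma twisted_transpose_carrier: "X \<in> carrier_mat n n \<Longrightarrow> twisted_transpose P Q X \<in> carrier_mat n n"
  unfolding twisted_transpose_def using P Q by (intro mult_carrier_mat[of _ n n]) auto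

lemma twisted_transpose_one: "twisted_transpose P Q (1\<^sub>m n) = 1\<^sub>m n"
  using P PQ by (simp add: twisted_transpose_def)

lemma twisted_transpose_mult:
  assumes X: "X \<in> carrier_mat n n" and Y: "Y \<in> carrier_mat n n"
  shows "twisted_transpose P Q (X * Y) = twisted_transpose P Q Y * twisted_transpose P Q X"
proof -
  note assoc = assoc_mult_mat[of _ n n _ n _ n] mult_carrier_mat[of _ n n _ n]
  have "Q * (P * (X\<^sup>T * Q)) = X\<^sup>T * Q"
    using X Q by (intro left_inverse_mult_cancel[OF Q P QP]) (auto intro: mult_carrier_mat)
  then show ?thesis
    using P Q X Y by (simp add: twisted_transpose_def transpose_mult[OF X Y] assoc)
qed

lemma twisted_transpose_minus:
  assumes X: "X \<in> carrier_mat n n" and Y: "Y \<in> carrier_mat n n"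
  shows "twisted_transpose P Q (X - Y) = twisted_transpose P Q X - twisted_transpose P Q Y"
proof -
  have XT: "X\<^sup>T \<in> carrier_mat n n" and YT: "Y\<^sup>T \<in> carrier_mat n n" using X Y by simp_all
  show ?thesis
    by (simp add: twisted_transpose_def transpose_minus[OF X Y] mult_minus_distrib_mat[OF P XT YT]
        minus_mult_distrib_mat[OF mult_carrier_mat[OF P XT] mult_carrier_mat[OF P YT] Q])
qed

lemma twisted_transpose_pow:
  assumes A: "A \<in> carrier_mat n n"
  shows "twisted_transpose P Q (A ^\<^sub>m k) = twisted_transpose P Q A ^\<^sub>m k"
proof (induction k)
  case 0
  have "dim_row (twisted_transpose P Q A) = n" using twisted_transpose_carrier[OF A] by simp
  then show ?case using A by (simp add: twisted_transpose_one)
next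
  case (Suc k)
  have "twisted_transpose P Q (A ^\<^sub>m Suc k)
      = twisted_transpose P Q A * twisted_transpose P Q (A ^\<^sub>m k)"
    using A by (simp add: twisted_transpose_mult)
  also have "\<dots> = twisted_transpose P Q A ^\<^sub>m Suc k"
    unfolding Suc.IH by (rule mult_pow_mat[OF twisted_transpose_carrier[OF A]])
  finally show ?case .
qed

lemma twisted_transpose_mat_poly:
  assumes A: "A \<in> carrier_mat n n"
  shows "twisted_transpose P Q (mat_poly n c A) = mat_poly n c (twisted_transpose P Q A)"
proof -
  have Ak: "A ^\<^sub>m k \<in> carrier_mat n n" for k using A by simp
  have "twisted_transpose P Q (mat_poly n c A) = mat_lincomb n n {..<n} c (\<lambda>k. P * (A ^\<^sub>m k)\<^sup>T * Q)"
    unfolding twisted_transpose_def mat_poly_def using Ak P Q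
    by (simp add: transpose_mat_lincomb mult_mat_lincomb[of _ n n] mat_lincomb_mult
        mult_carrier_mat[of _ n n])
  also have "\<dots> = mat_poly n c (twisted_transpose P Q A)"
    by (simp only: mat_poly_def twisted_transpose_pow[OF A, symmetric])
      (simp only: twisted_transpose_def)
  finally show ?thesis .
qed

lemma det_twisted_transpose:
  assumes X: "X \<in> carrier_mat n n"
  shows "det (twisted_transpose P Q X) = det X"
proof -
  have XT: "X\<^sup>T \<in> carrier_mat n n" using X by simp
  have "det (twisted_transpose P Q X) = det X * (det P * det Q)"
    by (simp add: twisted_transpose_def det_mult[OF mult_carrier_mat[OF P XT] Q] det_mult[OF P XT]
        det_transpose[OF X] mult.commute mult.left_commute)
  also have "det P * det Q = 1" using det_mult[OF P Q] PQ by simp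
  finally show ?thesis by simp
qed

lemma twisted_transpose_surj:
  assumes Y: "Y \<in> carrier_mat n n"
  obtains X where "X \<in> carrier_mat n n" "twisted_transpose P Q X = Y"
proof
  note assoc = assoc_mult_mat[of _ n n _ n _ n] mult_carrier_mat[of _ n n _ n]
  show "(Q * Y * P)\<^sup>T \<in> carrier_mat n n" using Q Y P by (simp add: assoc)
  show "twisted_transpose P Q ((Q * Y * P)\<^sup>T) = Y"
    using Q Y P PQ
    by (simp add: twisted_transpose_def assoc left_inverse_mult_cancel[OF P Q PQ, of _ n])
qed

lemma mat_trace_twisted_transpose:
  assumes X: "X \<in> carrier_mat n n"
  shows "mat_trace (twisted_transpose P Q X) = mat_trace X"
proof -
  have XT: "X\<^sup>T \<in> carrier_mat n n" using X by simp
  have "mat_trace (twisted_transpose P Q X) = mat_trace (Q * (P * X\<^sup>T))"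
    unfolding twisted_transpose_def by (rule mat_trace_commute[OF mult_carrier_mat[OF P XT] Q])
  also have "Q * (P * X\<^sup>T) = X\<^sup>T" by (rule left_inverse_mult_cancel[OF Q P QP XT])
  finally show ?thesis by (simp add: mat_trace_transpose[OF X])
qed

end

definition antidiag_mat :: "nat \<Rightarrow> (nat \<Rightarrow> 'r::comm_ring_1) \<Rightarrow> 'r mat" where
  "antidiag_mat n q = mat n n (\<lambda>(i, j). if j = n - Suc i then q i else 0)"

lemma antidiag_mat_carrier [simp]: "antidiag_mat n q \<in> carrier_mat n n"
  by (simp add: antidiag_mat_def)

lemma index_antidiag_mat_mult:
  assumes Y: "Y \<in> carrier_mat n m" and ij: "i < n" "j < m"
  shows "(antidiag_mat n q * Y) $$ (i, j) = q i * Y $$ (n - Suc i, j)"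
proof -
  have "(antidiag_mat n q * Y) $$ (i, j)
      = (\<Sum>k<n. if k = n - Suc i then q i * Y $$ (n - Suc i, j) else 0)"
    unfolding index_mult_mat_sum[OF antidiag_mat_carrier Y ij]
    using ij by (intro sum.cong refl) (auto simp: antidiag_mat_def)
  then show ?thesis using ij by simp
qed

lemma index_mult_antidiag_mat:
  assumes Y: "Y \<in> carrier_mat m n" and ij: "i < m" "j < n"
  shows "(Y * antidiag_mat n q) $$ (i, j) = Y $$ (i, n - Suc j) * q (n - Suc j)"
proof -
  have "(Y * antidiag_mat n q) $$ (i, j)
      = (\<Sum>k<n. if k = n - Suc j then Y $$ (i, n - Suc j) * q (n - Suc j) else 0)"
    unfolding index_mult_mat_sum[OF Y antidiag_mat_carrier ij]
    using ij by (intro sum.cong refl) (auto simp: antidiag_mat_def)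
  then show ?thesis using ij by simp
qed

lemma antidiag_mat_inverse:
  assumes "\<And>i. i < n \<Longrightarrow> q i * r (n - Suc i) = 1"
  shows "antidiag_mat n q * antidiag_mat n r = 1\<^sub>m n"
proof (rule eq_matI)
  fix i j assume "i < dim_row (1\<^sub>m n)" "j < dim_col (1\<^sub>m n)"
  then have "i < n" "j < n" by auto
  then show "(antidiag_mat n q * antidiag_mat n r) $$ (i, j) = 1\<^sub>m n $$ (i, j)"
    unfolding index_antidiag_mat_mult[OF antidiag_mat_carrier \<open>i < n\<close> \<open>j < n\<close>]
    using assms[of i] by (auto simp: antidiag_mat_def)
qed (auto simp: antidiag_mat_def)

lemma index_antidiag_twisted_transpose:
  assumes X: "X \<in> carrier_mat n n" and ij: "i < n" "j < n"
  shows "twisted_transpose (antidiag_mat n q) (antidiag_mat n r) X $$ (i, j)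
    = q i * X $$ (n - Suc j, n - Suc i) * r (n - Suc j)"
proof -
  have XT: "X\<^sup>T \<in> carrier_mat n n" using X by simp
  show ?thesis
    unfolding twisted_transpose_def
      index_mult_antidiag_mat[OF mult_carrier_mat[OF antidiag_mat_carrier XT] ij]
    using X ij by (subst index_antidiag_mat_mult[OF XT]) auto
qed

lemma upper_triangular_antidiag_twisted_transpose:
  assumes X: "X \<in> carrier_mat n n" "upper_triangular X"
  shows "upper_triangular (twisted_transpose (antidiag_mat n q) (antidiag_mat n r) X)"
proof (rule upper_triangularI)
  fix i j assume "j < i" "i < dim_row (twisted_transpose (antidiag_mat n q) (antidiag_mat n r) X)"
  then have ij: "j < i" "i < n" by (auto simp: twisted_transpose_def antidiag_mat_def)
  then show "twisted_transpose (antidiag_mat n q) (antidiag_mat n r) X $$ (i, j) = 0"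
    using X upper_triangularD[OF X(2), of "n - Suc i" "n - Suc j"]
    by (simp add: index_antidiag_twisted_transpose[OF X(1)])
qed

section \<open>Generating characters\<close>

definition generating_character :: "('r::comm_ring_1 \<Rightarrow> complex) \<Rightarrow> bool" where
  "generating_character psi \<longleftrightarrow> additive_character psi \<and> (\<forall>x. x \<noteq> 0 \<longrightarrow> (\<exists>r. psi (r * x) \<noteq> 1))"

lemma generating_character_additive: "generating_character psi \<Longrightarrow> additive_character psi"
  by (simp add: generating_character_def)

lemma additive_character_add: "additive_character psi \<Longrightarrow> psi (x + y) = psi x * psi y"
  and additive_character_nonzero: "additive_character psi \<Longrightarrow> psi x \<noteq> 0"
  by (auto simp: additive_character_def)

lemma additive_character_zero: "additive_character psi \<Longrightarrow> psi 0 = 1"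
  using additive_character_add[of psi 0 0] additive_character_nonzero[of psi 0] by simp

lemma additive_character_diff: "additive_character psi \<Longrightarrow> psi (x - y) = psi x / psi y"
  using additive_character_add[of psi "x - y" y] additive_character_nonzero[of psi y]
  by (simp add: field_simps)

lemma additive_character_sum:
  "additive_character psi \<Longrightarrow> psi (\<Sum>i\<in>S. f i) = (\<Prod>i\<in>S. psi (f i))"
  by (induction S rule: infinite_finite_induct)
    (auto simp: additive_character_zero additive_character_add)

lemma sum_multiplicative_function:
  fixes chi :: "'b::plus \<Rightarrow> complex"
  assumes "finite S" and closed: "\<And>s t. s \<in> S \<Longrightarrow> t \<in> S \<Longrightarrow> s + t \<in> S"
    and inj: "\<And>s. s \<in> S \<Longrightarrow> inj_on ((+) s) S"
    and mult: "\<And>s t. s \<in> S \<Longrightarrow> t \<in> S \<Longrightarrow> chi (s + t) = chi s * chi t"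
  shows "sum chi S = (if \<forall>s\<in>S. chi s = 1 then of_nat (card S) else 0)"
proof (cases "\<forall>s\<in>S. chi s = 1")
  case False
  then obtain s where s: "s \<in> S" "chi s \<noteq> 1" by blast
  have "(+) s ` S = S"
    using \<open>finite S\<close> closed inj s(1) by (intro endo_inj_surj) auto
  then have "sum chi S = (\<Sum>t\<in>S. chi (s + t))"
    using sum.reindex[OF inj[OF s(1)], of chi] by simp
  also have "\<dots> = chi s * sum chi S" by (simp add: mult s(1) sum_distrib_left)
  finally have "(1 - chi s) * sum chi S = 0" by (simp add: algebra_simps)
  then show ?thesis using s by auto
qed simp

lemma sum_generating_character:
  fixes psi :: "'r::comm_ring_1 \<Rightarrow> complex"
  assumes "finite (UNIV :: 'r set)" and psi: "generating_character psi"
  shows "(\<Sum>a\<in>UNIV. psi (a * x)) = (if x = 0 then of_nat (card (UNIV :: 'r set)) else 0)"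
proof -
  note add = generating_character_additive[OF psi]
  have "(\<forall>a\<in>UNIV. psi (a * x) = 1) \<longleftrightarrow> x = 0"
    using psi additive_character_zero[OF add] by (auto simp: generating_character_def)
  then show ?thesis
    using sum_multiplicative_function[of "UNIV :: 'r set" "\<lambda>a. psi (a * x)"] assms(1)
    by (simp add: distrib_right additive_character_add[OF add])
qed

lemma character_eq_generating_multiple:
  fixes psi chi :: "'r::comm_ring_1 \<Rightarrow> complex"
  assumes fin: "finite (UNIV :: 'r set)" and psi: "generating_character psi"
    and chi: "additive_character chi"
  obtains a where "\<And>x. chi x = psi (a * x)"
proof (rule ccontr)
  assume "\<not> thesis"
  then have distinct: "\<exists>x. chi x \<noteq> psi (a * x)" for a using that by metis
  note add = generating_character_additive[OF psi]
  have "(\<Sum>x\<in>UNIV. chi x * psi (a * x)) = 0" for a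
  proof -
    have "psi (- a * x) * psi (a * x) = 1" for x
      using additive_character_add[OF add, of "- a * x" "a * x"]
      by (simp add: additive_character_zero[OF add])
    then have "\<not> (\<forall>x\<in>UNIV. chi x * psi (a * x) = 1)"
      using distinct[of "- a"] additive_character_nonzero[OF add]
      by (metis mult_right_cancel UNIV_I)
    then show ?thesis
      using sum_multiplicative_function[of UNIV "\<lambda>x. chi x * psi (a * x)"] fin
      by (simp add: distrib_left additive_character_add[OF add] additive_character_add[OF chi]
          mult_ac)
  qed
  then have "0 = (\<Sum>a\<in>UNIV. \<Sum>x\<in>UNIV. chi x * psi (a * x))" by simp
  also have "\<dots> = (\<Sum>x\<in>UNIV. chi x * (\<Sum>a\<in>UNIV. psi (a * x)))"
    by (subst sum.swap) (simp add: sum_distrib_left)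
  also have "\<dots> = of_nat (card (UNIV :: 'r set))"
    using fin by (simp add: sum_generating_character[OF fin psi] if_distrib[of "(*) _"]
        additive_character_zero[OF chi] cong: if_cong)
  finally show False using fin by simp
qed

lemma generating_character_eq_unit_multiple:
  fixes psi chi :: "'r::comm_ring_1 \<Rightarrow> complex"
  assumes fin: "finite (UNIV :: 'r set)" and psi: "generating_character psi"
    and chi: "generating_character chi"
  obtains a b where "a * b = 1" "\<And>x. chi x = psi (a * x)"
proof -
  obtain a where a: "\<And>x. chi x = psi (a * x)"
    using character_eq_generating_multiple[OF fin psi generating_character_additive[OF chi]]
    by blast
  have "x = 0" if "a * x = 0" for x
  proof (rule ccontr)
    assume "x \<noteq> 0"
    then obtain r where "chi (r * x) \<noteq> 1" using chi by (auto simp: generating_character_def)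
    moreover have "a * (r * x) = 0" using that by (metis mult.left_commute mult_zero_right)
    ultimately show False
      using a additive_character_zero[OF generating_character_additive[OF psi]] by simp
  qed
  then have "inj ((*) a)" by (intro injI) (metis eq_iff_diff_eq_0 right_diff_distrib)
  then have "surj ((*) a)" using fin by (simp add: finite_UNIV_inj_surj)
  then obtain b where "a * b = 1" by (metis surjD)
  then show thesis using a by (rule that)
qed

lemma generating_characters_eq_unit_multiples:
  fixes psi :: "'r::comm_ring_1 \<Rightarrow> complex" and chi :: "nat \<Rightarrow> 'r \<Rightarrow> complex"
  assumes fin: "finite (UNIV :: 'r set)" and psi: "generating_character psi"
    and chi: "\<forall>i<m. generating_character (chi i)"
  obtains a b where "\<And>i. a i * b i = 1" "\<And>i x. i < m \<Longrightarrow> chi i x = psi (a i * x)"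
proof -
  have "\<forall>i. \<exists>a b. a * b = 1 \<and> (i < m \<longrightarrow> (\<forall>x. chi i x = psi (a * x)))"
  proof
    fix i show "\<exists>a b. a * b = 1 \<and> (i < m \<longrightarrow> (\<forall>x. chi i x = psi (a * x)))"
    proof (cases "i < m")
      case True
      then have "generating_character (chi i)" using chi by blast
      then show ?thesis using generating_character_eq_unit_multiple[OF fin psi] by metis
    next
      case False
      then show ?thesis by (intro exI[of _ 1]) simp
    qed
  qed
  from choice[OF this] obtain a
    where "\<forall>i. \<exists>b. a i * b = 1 \<and> (i < m \<longrightarrow> (\<forall>x. chi i x = psi (a i * x)))" ..
  from choice[OF this] obtain b
    where "\<forall>i. a i * b i = 1 \<and> (i < m \<longrightarrow> (\<forall>x. chi i x = psi (a i * x)))" ..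
  then show thesis using that by blast
qed

section \<open>Trace duality\<close>

lemma finite_carrier_mat:
  assumes "finite (UNIV :: 'r set)"
  shows "finite (carrier_mat n m :: 'r mat set)"
proof (rule finite_subset)
  let ?I = "{..<n} \<times> {..<m}"
  show "carrier_mat n m \<subseteq> mat n m ` (?I \<rightarrow>\<^sub>E (UNIV :: 'r set))"
  proof
    fix A :: "'r mat" assume "A \<in> carrier_mat n m"
    then have "A = mat n m (restrict (($$) A) ?I)" by (intro eq_matI) auto
    moreover have "restrict (($$) A) ?I \<in> ?I \<rightarrow>\<^sub>E UNIV" by (simp only: restrict_PiE_iff) simp
    ultimately show "A \<in> mat n m ` (?I \<rightarrow>\<^sub>E UNIV)" by (rule image_eqI)
  qed
  show "finite (mat n m ` (?I \<rightarrow>\<^sub>E (UNIV :: 'r set)))"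
    using assms by (intro finite_imageI finite_PiE) auto
qed

lemma inj_on_add_mat:
  fixes X :: "'r::comm_ring_1 mat"
  assumes X: "X \<in> carrier_mat n m" and S: "S \<subseteq> carrier_mat n m"
  shows "inj_on ((+) X) S"
proof (rule inj_onI)
  fix Y Z assume "Y \<in> S" "Z \<in> S" and eq: "X + Y = X + Z"
  then have carrier: "Y \<in> carrier_mat n m" "Z \<in> carrier_mat n m" using S by auto
  show "Y = Z"
  proof (rule eq_matI)
    fix i j assume "i < dim_row Z" "j < dim_col Z"
    moreover have "(X + Y) $$ (i, j) = (X + Z) $$ (i, j)" by (simp only: eq)
    ultimately show "Y $$ (i, j) = Z $$ (i, j)" using X carrier by simp
  qed (use carrier in auto)
qed

definition elementary_mat :: "nat \<Rightarrow> nat \<Rightarrow> nat \<Rightarrow> 'r::comm_ring_1 \<Rightarrow> 'r mat" where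
  "elementary_mat n i j r = mat n n (\<lambda>p. if p = (i, j) then r else 0)"

lemma elementary_mat_carrier [simp]: "elementary_mat n i j r \<in> carrier_mat n n"
  by (simp add: elementary_mat_def)

lemma mat_trace_mult_elementary:
  assumes N: "N \<in> carrier_mat n n" and ij: "i < n" "j < n"
  shows "mat_trace (N * elementary_mat n i j r) = r * N $$ (j, i)"
proof -
  have "mat_trace (N * elementary_mat n i j r)
      = (\<Sum>k<n. \<Sum>l<n. if l = i then if k = j then r * N $$ (j, i) else 0 else 0)"
    unfolding mat_trace_mult[OF N elementary_mat_carrier]
    by (intro sum.cong refl) (auto simp: elementary_mat_def mult.commute)
  then show ?thesis using ij by simp
qed

definition trace_annihilator ::
  "nat \<Rightarrow> ('r::comm_ring_1 \<Rightarrow> complex) \<Rightarrow> 'r mat set \<Rightarrow> 'r mat set" where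
  "trace_annihilator n psi S = {N \<in> carrier_mat n n. \<forall>X\<in>S. psi (mat_trace (N * X)) = 1}"

lemma trace_annihilatorD:
  "N \<in> trace_annihilator n psi S \<Longrightarrow> X \<in> S \<Longrightarrow> psi (mat_trace (N * X)) = 1"
  by (simp add: trace_annihilator_def)

lemma trace_annihilator_carrier: "N \<in> trace_annihilator n psi S \<Longrightarrow> N \<in> carrier_mat n n"
  by (simp add: trace_annihilator_def)

lemma trace_character_add_right:
  assumes "additive_character psi" "N \<in> carrier_mat n n" "X \<in> carrier_mat n n" "Y \<in> carrier_mat n n"
  shows "psi (mat_trace (N * (X + Y))) = psi (mat_trace (N * X)) * psi (mat_trace (N * Y))"
  by (simp add: mult_add_distrib_mat[OF assms(2-4)]
      mat_trace_add[OF mult_carrier_mat mult_carrier_mat, OF assms(2,3,2,4)]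
      additive_character_add[OF assms(1)])

lemma trace_character_add_left:
  assumes "additive_character psi" "M \<in> carrier_mat n n" "N \<in> carrier_mat n n" "X \<in> carrier_mat n n"
  shows "psi (mat_trace ((M + N) * X)) = psi (mat_trace (M * X)) * psi (mat_trace (N * X))"
  by (simp add: add_mult_distrib_mat[OF assms(2-4)]
      mat_trace_add[OF mult_carrier_mat mult_carrier_mat, OF assms(2,4,3,4)]
      additive_character_add[OF assms(1)])

lemma trace_character_minus_right:
  assumes "additive_character psi" "N \<in> carrier_mat n n" "X \<in> carrier_mat n n" "Y \<in> carrier_mat n n"
  shows "psi (mat_trace (N * (X - Y))) = psi (mat_trace (N * X)) / psi (mat_trace (N * Y))"
  by (simp add: mult_minus_distrib_mat[OF assms(2-4)]
      mat_trace_minus[OF mult_carrier_mat mult_carrier_mat, OF assms(2,3,2,4)]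
      additive_character_diff[OF assms(1)])

lemma sum_trace_character_left:
  fixes psi :: "'r::comm_ring_1 \<Rightarrow> complex"
  assumes fin: "finite (UNIV :: 'r set)" and psi: "generating_character psi"
    and X: "X \<in> carrier_mat n n" "X \<noteq> 0\<^sub>m n n"
  shows "(\<Sum>N\<in>carrier_mat n n. psi (mat_trace (N * X))) = 0"
proof -
  note add = generating_character_additive[OF psi]
  obtain i j where ij: "i < n" "j < n" "X $$ (i, j) \<noteq> 0"
    using X by (metis carrier_matD eq_matI index_zero_mat)
  obtain r where r: "psi (r * X $$ (i, j)) \<noteq> 1"
    using psi ij(3) by (auto simp: generating_character_def)
  have "mat_trace (elementary_mat n j i r * X) = r * X $$ (i, j)"
    using mat_trace_commute[OF elementary_mat_carrier X(1)]
      mat_trace_mult_elementary[OF X(1) ij(2,1)] by simp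
  then have "\<not> (\<forall>N\<in>carrier_mat n n. psi (mat_trace (N * X)) = 1)"
    using r elementary_mat_carrier by metis
  moreover have "(\<Sum>N\<in>carrier_mat n n. psi (mat_trace (N * X)))
      = (if \<forall>N\<in>carrier_mat n n. psi (mat_trace (N * X)) = 1
         then of_nat (card (carrier_mat n n :: 'r mat set))
         else 0)"
    by (intro sum_multiplicative_function finite_carrier_mat fin inj_on_add_mat[OF _ subset_refl]
        trace_character_add_left[OF add _ _ X(1)] add_carrier_mat)
  ultimately show ?thesis by (simp only: if_False)
qed

lemma sum_trace_character_right:
  fixes psi :: "'r::comm_ring_1 \<Rightarrow> complex"
  assumes fin: "finite (UNIV :: 'r set)" and psi: "additive_character psi"
    and S: "S \<subseteq> carrier_mat n n" "\<And>s t. s \<in> S \<Longrightarrow> t \<in> S \<Longrightarrow> s + t \<in> S"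
    and N: "N \<in> carrier_mat n n"
  shows "(\<Sum>s\<in>S. psi (mat_trace (N * s)))
      = (if N \<in> trace_annihilator n psi S then of_nat (card S) else 0)"
proof -
  have "(\<Sum>s\<in>S. psi (mat_trace (N * s)))
      = (if \<forall>s\<in>S. psi (mat_trace (N * s)) = 1 then of_nat (card S) else 0)"
    by (intro sum_multiplicative_function finite_subset[OF S(1) finite_carrier_mat[OF fin]] S(2)
        inj_on_add_mat[OF _ S(1)] trace_character_add_right[OF psi N] subsetD[OF S(1)])
  then show ?thesis using N by (simp add: trace_annihilator_def)
qed

lemma double_trace_annihilator:
  fixes psi :: "'r::comm_ring_1 \<Rightarrow> complex"
  assumes fin: "finite (UNIV :: 'r set)" and psi: "generating_character psi"
    and S: "S \<subseteq> carrier_mat n n" "\<And>s t. s \<in> S \<Longrightarrow> t \<in> S \<Longrightarrow> s + t \<in> S" "S \<noteq> {}"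
    and D: "D \<in> carrier_mat n n"
    and ann: "\<And>N. N \<in> trace_annihilator n psi S \<Longrightarrow> psi (mat_trace (N * D)) = 1"
  shows "D \<in> S"
proof (rule ccontr)
  assume "D \<notin> S"
  note add = generating_character_additive[OF psi]
  let ?C = "carrier_mat n n :: 'r mat set" and ?A = "trace_annihilator n psi S"
  have finC: "finite ?C" by (rule finite_carrier_mat[OF fin])
  have "(\<Sum>N\<in>?C. psi (mat_trace (N * (s - D)))) = 0" if s: "s \<in> S" for s
  proof (rule sum_trace_character_left[OF fin psi])
    show "s - D \<noteq> 0\<^sub>m n n"
    proof
      assume "s - D = 0\<^sub>m n n"
      moreover have "s = (s - D) + D" using s S(1) D by (intro eq_matI) auto
      ultimately have "s = D" using D by simp
      then show False using s \<open>D \<notin> S\<close> by simp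
    qed
  qed (use D in \<open>simp add: minus_carrier_mat\<close>)
  then have "0 = (\<Sum>s\<in>S. \<Sum>N\<in>?C. psi (mat_trace (N * (s - D))))" by simp
  also have "\<dots> = (\<Sum>N\<in>?C. \<Sum>s\<in>S. psi (mat_trace (N * s)) / psi (mat_trace (N * D)))"
    using S(1) D by (subst sum.swap)
      (auto intro!: sum.cong simp: trace_character_minus_right[OF add])
  also have "\<dots> = (\<Sum>N\<in>?C. if N \<in> ?A then of_nat (card S) else 0)"
    by (intro sum.cong refl)
      (simp add: sum_divide_distrib[symmetric] sum_trace_character_right[OF fin add S(1,2)] ann)
  also have "\<dots> = of_nat (card ?A) * of_nat (card S)"
    using finC by (simp add: sum.If_cases trace_annihilator_def Int_def)
  finally have "card ?A = 0 \<or> card S = 0" by simp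
  moreover have "finite ?A" "finite S"
    using finC S(1) by (auto simp: trace_annihilator_def intro: finite_subset)
  moreover have "0\<^sub>m n n \<in> ?A"
    using S(1) by (auto simp: trace_annihilator_def mat_trace_def additive_character_zero[OF add])
  ultimately show False using S(3) by auto
qed

section \<open>Functions equivariant under a non-degenerate character\<close>

definition upper_triangular_mats :: "nat \<Rightarrow> 'r::comm_ring_1 mat set" where
  "upper_triangular_mats n = {X \<in> carrier_mat n n. upper_triangular X}"

lemma upper_triangular_mats_carrier: "X \<in> upper_triangular_mats n \<Longrightarrow> X \<in> carrier_mat n n"
  by (simp add: upper_triangular_mats_def)

lemma zero_in_upper_triangular_mats: "0\<^sub>m n n \<in> upper_triangular_mats n"
  by (simp add: upper_triangular_mats_def)

lemma add_in_upper_triangular_mats: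
  "X \<in> upper_triangular_mats n \<Longrightarrow> Y \<in> upper_triangular_mats n \<Longrightarrow> X + Y \<in> upper_triangular_mats n"
  by (auto simp: upper_triangular_mats_def upper_triangular_def)

lemma hessenberg_subdiagonal_add:
  "X \<in> upper_triangular_mats n \<Longrightarrow> hessenberg n a (subdiagonal_mat n a + X)"
  and hessenberg_subdiagonal_minus:
  "X \<in> upper_triangular_mats n \<Longrightarrow> hessenberg n a (subdiagonal_mat n a - X)"
  by (auto simp: upper_triangular_mats_def upper_triangular_def hessenberg_def subdiagonal_mat_def
      minus_carrier_mat)

definition conj_upper_sum :: "nat \<Rightarrow> 'r::comm_ring_1 mat \<Rightarrow> 'r mat \<Rightarrow> 'r mat set" where
  "conj_upper_sum n g h =
     {X + g * Y * h | X Y. X \<in> upper_triangular_mats n \<and> Y \<in> upper_triangular_mats n}"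

context
  fixes n :: nat and g h :: "'r::comm_ring_1 mat"
  assumes g: "g \<in> carrier_mat n n" and h: "h \<in> carrier_mat n n"
begin

lemma conj_mat_carrier: "Y \<in> carrier_mat n n \<Longrightarrow> g * Y * h \<in> carrier_mat n n"
  using g h by (meson mult_carrier_mat)

lemma conj_mat_add:
  assumes X: "X \<in> carrier_mat n n" and Y: "Y \<in> carrier_mat n n"
  shows "g * (X + Y) * h = g * X * h + g * Y * h"
  by (simp add: mult_add_distrib_mat[OF g X Y]
      add_mult_distrib_mat[OF mult_carrier_mat[OF g X] mult_carrier_mat[OF g Y] h])

lemma conj_upper_sum_carrier: "conj_upper_sum n g h \<subseteq> carrier_mat n n"
  by (auto simp: conj_upper_sum_def upper_triangular_mats_def
      intro!: add_carrier_mat conj_mat_carrier)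

lemma conj_upper_sum_add:
  assumes "s \<in> conj_upper_sum n g h" "t \<in> conj_upper_sum n g h"
  shows "s + t \<in> conj_upper_sum n g h"
proof -
  obtain X Y where XY: "X \<in> upper_triangular_mats n" "Y \<in> upper_triangular_mats n"
    "s = X + g * Y * h"
    using assms(1) by (auto simp: conj_upper_sum_def)
  obtain X' Y' where XY': "X' \<in> upper_triangular_mats n" "Y' \<in> upper_triangular_mats n"
    "t = X' + g * Y' * h"
    using assms(2) by (auto simp: conj_upper_sum_def)
  note carrier = upper_triangular_mats_carrier[OF XY(1)] upper_triangular_mats_carrier[OF XY(2)]
    upper_triangular_mats_carrier[OF XY'(1)] upper_triangular_mats_carrier[OF XY'(2)]
  have "s + t = (X + X') + g * (Y + Y') * h"
    using carrier conj_mat_carrier[OF carrier(2)] conj_mat_carrier[OF carrier(4)]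
    by (intro eq_matI) (auto simp: XY(3) XY'(3) conj_mat_add simp del: index_mult_mat(1))
  then show ?thesis
    unfolding conj_upper_sum_def using XY XY' add_in_upper_triangular_mats by blast
qed

lemma upper_triangular_mats_subset_conj_upper_sum: "upper_triangular_mats n \<subseteq> conj_upper_sum n g h"
proof
  fix X :: "'r mat" assume X: "X \<in> upper_triangular_mats n"
  have "X = X + g * 0\<^sub>m n n * h" using g h upper_triangular_mats_carrier[OF X] by simp
  then show "X \<in> conj_upper_sum n g h"
    unfolding conj_upper_sum_def using X zero_in_upper_triangular_mats by blast
qed

lemma conj_upper_triangular_in_conj_upper_sum:
  assumes Y: "Y \<in> upper_triangular_mats n"
  shows "g * Y * h \<in> conj_upper_sum n g h"
proof -
  have "g * Y * h = 0\<^sub>m n n + g * Y * h"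
    using conj_mat_carrier[OF upper_triangular_mats_carrier[OF Y]] by simp
  then show ?thesis
    unfolding conj_upper_sum_def using Y zero_in_upper_triangular_mats by blast
qed

lemma mat_trace_conj:
  assumes N: "N \<in> carrier_mat n n" and Y: "Y \<in> carrier_mat n n"
  shows "mat_trace (h * N * g * Y) = mat_trace (N * (g * Y * h))"
proof -
  note assoc = assoc_mult_mat[of _ n n _ n _ n] mult_carrier_mat[of _ n n _ n]
  have "mat_trace (h * (N * (g * Y))) = mat_trace (N * (g * Y) * h)"
    using N Y g h by (intro mat_trace_commute[of _ n n]) (simp_all add: assoc)
  then show ?thesis using N Y g h by (simp add: assoc)
qed

lemma trace_annihilator_conj:
  assumes N: "N \<in> trace_annihilator n psi (conj_upper_sum n g h)"
  shows "h * N * g \<in> trace_annihilator n psi (upper_triangular_mats n)"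
  unfolding trace_annihilator_def
proof (intro CollectI conjI ballI)
  note Nc = trace_annihilator_carrier[OF N]
  show "h * N * g \<in> carrier_mat n n" using g h Nc by (meson mult_carrier_mat)
  fix Y :: "'r mat" assume Y: "Y \<in> upper_triangular_mats n"
  show "psi (mat_trace (h * N * g * Y)) = 1"
    unfolding mat_trace_conj[OF Nc upper_triangular_mats_carrier[OF Y]]
    by (rule trace_annihilatorD[OF N conj_upper_triangular_in_conj_upper_sum[OF Y]])
qed

lemma hessenberg_intertwined_if_conj_upper_sum:
  assumes hg: "h * g = 1\<^sub>m n"
    and D: "subdiagonal_mat n a - g * subdiagonal_mat n a * h \<in> conj_upper_sum n g h"
  obtains A B where "hessenberg n a A" "hessenberg n a B" "A * g = g * B"
proof -
  let ?J = "subdiagonal_mat n a"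
  note assoc = assoc_mult_mat[of _ n n _ n _ n] mult_carrier_mat[of _ n n _ n]
  obtain X Y where XY: "X \<in> upper_triangular_mats n" "Y \<in> upper_triangular_mats n"
    and eq: "?J - g * ?J * h = X + g * Y * h"
    using D by (auto simp: conj_upper_sum_def)
  note carrier = upper_triangular_mats_carrier[OF XY(1)] upper_triangular_mats_carrier[OF XY(2)]
  have "?J - X = g * (?J + Y) * h"
  proof (rule eq_matI)
    fix i j assume "i < dim_row (g * (?J + Y) * h)" "j < dim_col (g * (?J + Y) * h)"
    then have "i < n" "j < n" using g h by auto
    moreover have "(?J - g * ?J * h) $$ (i, j) = (X + g * Y * h) $$ (i, j)" by (simp only: eq)
    ultimately show "(?J - X) $$ (i, j) = (g * (?J + Y) * h) $$ (i, j)"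
      using carrier g h by (simp add: conj_mat_add diff_eq_eq add_ac del: index_mult_mat(1))
  qed (use carrier g h in auto)
  then have "(?J - X) * g = g * (?J + Y)"
    using carrier g h hg by (simp add: assoc)
  then show thesis
    by (rule that[OF hessenberg_subdiagonal_minus[OF XY(1)] hessenberg_subdiagonal_add[OF XY(2)]])
qed

end

locale nondegenerate_character =
  fixes n :: nat and psi :: "'r::comm_ring_1 \<Rightarrow> complex" and a b :: "nat \<Rightarrow> 'r"
  assumes finite_ring: "finite (UNIV :: 'r set)" and generating: "generating_character psi"
    and units: "\<And>i. a i * b i = 1"
begin

abbreviation J :: "'r mat" where "J \<equiv> subdiagonal_mat n a"

definition theta :: "'r mat \<Rightarrow> complex" where "theta u = psi (mat_trace (u * J))"

text \<open>The weights are chosen so that \<open>sigma\<close> fixes \<open>J\<close>.\<close>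
definition flip_weight :: "nat \<Rightarrow> 'r" where
  "flip_weight i = (\<Prod>k<i. a k * b (n - Suc (Suc k)))"

definition flip_coweight :: "nat \<Rightarrow> 'r" where
  "flip_coweight i = (\<Prod>k<i. b k * a (n - Suc (Suc k)))"

definition sigma :: "'r mat \<Rightarrow> 'r mat" where
  "sigma = twisted_transpose (antidiag_mat n flip_weight)
     (antidiag_mat n (\<lambda>i. flip_coweight (n - Suc i)))"

lemma psi_additive: "additive_character psi"
  by (rule generating_character_additive[OF generating])

lemma theta_nonzero: "theta u \<noteq> 0"
  by (simp add: theta_def additive_character_nonzero[OF psi_additive])

lemma theta_superdiag:
  assumes u: "u \<in> carrier_mat n n"
  shows "theta u = psi (\<Sum>i<n - 1. a i * u $$ (i, Suc i))"
proof -
  have "mat_trace (u * J) = (\<Sum>i<n. \<Sum>j<n. if j = Suc i then a i * u $$ (i, Suc i) else 0)"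
    unfolding mat_trace_mult[OF u subdiagonal_mat_carrier]
    by (intro sum.cong refl) (auto simp: subdiagonal_mat_def)
  also have "\<dots> = (\<Sum>i<n. if Suc i < n then a i * u $$ (i, Suc i) else 0)"
    by (intro sum.cong refl) auto
  also have "\<dots> = (\<Sum>i<n - 1. a i * u $$ (i, Suc i))"
    by (intro sum.mono_neutral_cong_right) auto
  finally show ?thesis by (simp add: theta_def)
qed

lemma theta_mult:
  assumes uv: "u \<in> UTn n" "v \<in> UTn n"
  shows "theta (u * v) = theta u * theta v"
proof -
  have "(\<Sum>i<n - 1. a i * (u * v) $$ (i, Suc i))
      = (\<Sum>i<n - 1. a i * u $$ (i, Suc i)) + (\<Sum>i<n - 1. a i * v $$ (i, Suc i))"
    unfolding sum.distrib[symmetric]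
    by (intro sum.cong refl)
      (simp add: UTn_mult_superdiag[OF uv] distrib_left del: index_mult_mat(1))
  then show ?thesis
    using uv
    by (simp add: theta_superdiag UTn_carrier UTn_mult additive_character_add[OF psi_additive])
qed

lemma flip_weight_mult_coweight: "flip_weight i * flip_coweight i = 1"
proof -
  have "a k * b (n - Suc (Suc k)) * (b k * a (n - Suc (Suc k))) = 1" for k
    using units[of k] units[of "n - Suc (Suc k)"] by (metis mult.assoc mult.commute mult_1_right)
  then show ?thesis unfolding flip_weight_def flip_coweight_def prod.distrib[symmetric] by simp
qed

lemma antidiag_flip_inverse:
  "antidiag_mat n flip_weight * antidiag_mat n (\<lambda>i. flip_coweight (n - Suc i)) = 1\<^sub>m n"
  "antidiag_mat n (\<lambda>i. flip_coweight (n - Suc i)) * antidiag_mat n flip_weight = 1\<^sub>m n"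
  by (intro antidiag_mat_inverse;
      simp add: flip_weight_mult_coweight mult.commute[of "flip_coweight _"])+

lemmas sigma_rules = antidiag_mat_carrier antidiag_mat_carrier antidiag_flip_inverse

lemmas sigma_carrier = twisted_transpose_carrier[OF sigma_rules, folded sigma_def]
lemmas sigma_mult = twisted_transpose_mult[OF sigma_rules, folded sigma_def]
lemmas sigma_minus = twisted_transpose_minus[OF sigma_rules, folded sigma_def]
lemmas sigma_pow = twisted_transpose_pow[OF sigma_rules, folded sigma_def]
lemmas sigma_mat_poly = twisted_transpose_mat_poly[OF sigma_rules, folded sigma_def]
lemmas det_sigma = det_twisted_transpose[OF sigma_rules, folded sigma_def]
lemmas sigma_surj = twisted_transpose_surj[OF sigma_rules, folded sigma_def]
lemmas mat_trace_sigma = mat_trace_twisted_transpose[OF sigma_rules, folded sigma_def]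

lemma index_sigma:
  assumes "X \<in> carrier_mat n n" "i < n" "j < n"
  shows "sigma X $$ (i, j) = flip_weight i * X $$ (n - Suc j, n - Suc i) * flip_coweight j"
  using assms by (simp add: sigma_def index_antidiag_twisted_transpose)

lemma sigma_subdiagonal: "sigma J = J"
proof (rule eq_matI)
  fix i j assume "i < dim_row J" "j < dim_col J"
  then have ij: "i < n" "j < n" by (auto simp: subdiagonal_mat_def)
  show "sigma J $$ (i, j) = J $$ (i, j)"
  proof (cases "i = Suc j")
    case True
    have "flip_weight (Suc j) * a (n - Suc (Suc j)) * flip_coweight j
        = a j * (a (n - Suc (Suc j)) * b (n - Suc (Suc j))) * (flip_weight j * flip_coweight j)"
      by (simp add: flip_weight_def algebra_simps)
    then show ?thesis
      using ij True by (auto simp: index_sigma subdiagonal_mat_def units flip_weight_mult_coweight)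
  next
    case False
    then have "n - Suc j \<noteq> Suc (n - Suc i)" using ij by linarith
    then show ?thesis using ij False by (simp add: index_sigma subdiagonal_mat_def)
  qed
qed (use sigma_carrier[OF subdiagonal_mat_carrier, of a] in \<open>auto simp: subdiagonal_mat_def\<close>)

lemma theta_sigma:
  assumes u: "u \<in> carrier_mat n n"
  shows "theta (sigma u) = theta u"
proof -
  have "sigma u * J = sigma (J * u)" by (simp add: sigma_mult[OF _ u] sigma_subdiagonal)
  then show ?thesis
    using mat_trace_sigma[OF mult_carrier_mat[OF subdiagonal_mat_carrier u]]
      mat_trace_commute[OF subdiagonal_mat_carrier u] by (simp add: theta_def)
qed

lemma sigma_UTn:
  assumes u: "u \<in> UTn n"
  shows "sigma u \<in> UTn n"
proof -
  have "upper_triangular (sigma u)"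
    unfolding sigma_def
    by (rule upper_triangular_antidiag_twisted_transpose[OF UTn_carrier[OF u]
          UTn_upper_triangular[OF u]])
  then show ?thesis
    using u by (simp add: UTn_iff sigma_carrier index_sigma flip_weight_mult_coweight)
qed

lemma sigma_hessenberg:
  assumes A: "hessenberg n a A"
  shows "hessenberg n a (sigma A)"
proof -
  note Ac = hessenberg_carrier[OF A]
  have "sigma (A - J) = sigma A - J"
    by (simp add: sigma_minus[OF Ac] sigma_subdiagonal)
  moreover have "upper_triangular (sigma (A - J))"
    unfolding sigma_def using A
    by (intro upper_triangular_antidiag_twisted_transpose)
      (auto simp: hessenberg_def minus_carrier_mat)
  ultimately show ?thesis by (simp add: hessenberg_def sigma_carrier[OF Ac])
qed

lemma one_add_annihilator_in_UTn:
  assumes N: "N \<in> trace_annihilator n psi (upper_triangular_mats n)"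
  shows "1\<^sub>m n + N \<in> UTn n"
proof -
  note Nc = trace_annihilator_carrier[OF N]
  have "N $$ (j, i) = 0" if ij: "i \<le> j" "j < n" for i j
  proof (rule ccontr)
    assume "N $$ (j, i) \<noteq> 0"
    then obtain r where "psi (r * N $$ (j, i)) \<noteq> 1"
      using generating by (auto simp: generating_character_def)
    moreover have "elementary_mat n i j r \<in> upper_triangular_mats n"
      using ij by (auto simp: upper_triangular_mats_def upper_triangular_def elementary_mat_def)
    ultimately show False
      using trace_annihilatorD[OF N, of "elementary_mat n i j r"]
        mat_trace_mult_elementary[OF Nc, of i j r] ij
      by simp
  qed
  then show ?thesis using Nc by (auto simp: UTn_iff intro!: upper_triangularI)
qed

lemma theta_one_add:
  assumes N: "N \<in> carrier_mat n n"
  shows "theta (1\<^sub>m n + N) = psi (mat_trace (N * J))"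
proof -
  have "mat_trace J = 0" by (auto simp: mat_trace_def subdiagonal_mat_def)
  then show ?thesis
    using trace_character_add_left[OF psi_additive one_carrier_mat N subdiagonal_mat_carrier]
    by (simp add: theta_def additive_character_zero[OF psi_additive]
        left_mult_one_mat[OF subdiagonal_mat_carrier])
qed

lemma theta_separated_if_annihilator:
  assumes g: "g \<in> carrier_mat n n" and h: "h \<in> carrier_mat n n" and gh: "g * h = 1\<^sub>m n"
    and N: "N \<in> trace_annihilator n psi (conj_upper_sum n g h)"
    and D: "psi (mat_trace (N * (J - g * J * h))) \<noteq> 1"
  obtains u v where "u \<in> UTn n" "v \<in> UTn n" "u * g = g * v" "theta u \<noteq> theta v"
proof (rule that)
  note Nc = trace_annihilator_carrier[OF N]
  note assoc = assoc_mult_mat[of _ n n _ n _ n] mult_carrier_mat[of _ n n _ n]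
  note hNg = trace_annihilator_carrier[OF trace_annihilator_conj[OF g h N]]
  show "1\<^sub>m n + N \<in> UTn n"
    using N upper_triangular_mats_subset_conj_upper_sum[OF g h]
    by (intro one_add_annihilator_in_UTn) (auto simp: trace_annihilator_def)
  show "1\<^sub>m n + h * N * g \<in> UTn n"
    by (rule one_add_annihilator_in_UTn[OF trace_annihilator_conj[OF g h N]])
  have "g * (h * N * g) = N * g"
    using g h Nc by (simp add: assoc left_inverse_mult_cancel[OF g h gh, of _ n])
  then show "(1\<^sub>m n + N) * g = g * (1\<^sub>m n + h * N * g)"
    using g by (simp add: add_mult_distrib_mat[OF one_carrier_mat Nc g]
        mult_add_distrib_mat[OF g one_carrier_mat hNg])
  have "theta (1\<^sub>m n + N) / theta (1\<^sub>m n + h * N * g) = psi (mat_trace (N * (J - g * J * h)))"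
    by (simp add: theta_one_add[OF Nc] theta_one_add[OF hNg] mat_trace_conj[OF g h Nc]
        trace_character_minus_right[OF psi_additive Nc _ conj_mat_carrier[OF g h]])
  then show "theta (1\<^sub>m n + N) \<noteq> theta (1\<^sub>m n + h * N * g)"
    using D theta_nonzero by auto
qed

text \<open>Since \<open>U = 1 + \<nn>\<close>, compatibility of \<open>theta\<close> with conjugation by \<open>g\<close> is a linear condition: it says
  that \<open>J - g J g\<^sup>-\<^sup>1\<close> is orthogonal to \<open>\<nn> \<inter> g \<nn> g\<^sup>-\<^sup>1\<close>, i.e. lies in \<open>\<bb> + g \<bb> g\<^sup>-\<^sup>1\<close> (upper triangular
  matrices).\<close>
lemma intertwining_dichotomy:
  assumes g: "g \<in> carrier_mat n n" and h: "h \<in> carrier_mat n n"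
    and gh: "g * h = 1\<^sub>m n" and hg: "h * g = 1\<^sub>m n"
  obtains
    (separated) u v where "u \<in> UTn n" "v \<in> UTn n" "u * g = g * v" "theta u \<noteq> theta v"
  | (hessenberg) A B where "hessenberg n a A" "hessenberg n a B" "A * g = g * B"
proof (cases "\<forall>N\<in>trace_annihilator n psi (conj_upper_sum n g h).
    psi (mat_trace (N * (J - g * J * h))) = 1")
  case True
  have "J - g * J * h \<in> conj_upper_sum n g h"
  proof (rule double_trace_annihilator[OF finite_ring generating])
    show "conj_upper_sum n g h \<noteq> {}"
      using upper_triangular_mats_subset_conj_upper_sum[OF g h] zero_in_upper_triangular_mats
      by blast
  qed (use True conj_upper_sum_carrier[OF g h] conj_upper_sum_add[OF g h] conj_mat_carrier[OF g h]
      in \<open>auto simp: minus_carrier_mat\<close>)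
  then show thesis by (rule hessenberg_intertwined_if_conj_upper_sum[OF g h hg _ hessenberg])
next
  case False
  then show thesis using theta_separated_if_annihilator[OF g h gh] separated by blast
qed

lemma sigma_hessenberg_conjugate:
  assumes B: "hessenberg n a B"
  obtains v where "v \<in> UTn n" "\<And>c. sigma (mat_poly n c B) * v = v * mat_poly n c B"
proof -
  note Bc = hessenberg_carrier[OF B]
  obtain c where c: "B ^\<^sub>m n = mat_poly n c B" by (rule hessenberg_monic_relation[OF units B])
  have "sigma B ^\<^sub>m n = mat_poly n c (sigma B)"
    by (simp only: sigma_pow[OF Bc, symmetric] c sigma_mat_poly[OF Bc])
  then obtain v where v: "v \<in> UTn n" "sigma B * v = v * B"
    using hessenberg_conjugate[OF units sigma_hessenberg[OF B] B _ c] by blast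
  then have "sigma (mat_poly n c B) * v = v * mat_poly n c B" for c
    unfolding sigma_mat_poly[OF Bc]
    by (intro mat_poly_intertwine sigma_carrier Bc UTn_carrier)
  with v(1) show thesis by (rule that)
qed

lemma sigma_invariant:
  assumes G: "mat_group n G" "UTn n \<subseteq> G" "sigma ` G \<subseteq> G"
    and f: "bi_equivariant G (UTn n) theta f" and g: "g \<in> G"
  shows "f (sigma g) = f g"
proof -
  interpret G: mat_group n G by (rule G(1))
  have sigma_G: "sigma x \<in> G" if "x \<in> G" for x using that G(3) by blast
  note gc = G.carrierD[OF g]
  obtain h where h: "h \<in> G" "g * h = 1\<^sub>m n" "h * g = 1\<^sub>m n" using G.inverse_closed[OF g] by auto
  from gc G.carrierD[OF h(1)] h(2,3) show ?thesis
  proof (cases rule: intertwining_dichotomy)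
    case (separated u v)
    have "sigma v * sigma g = sigma g * sigma u"
      using sigma_mult[OF UTn_carrier[OF separated(1)] gc]
        sigma_mult[OF gc UTn_carrier[OF separated(2)]] separated(3) by simp
    then have "f (sigma g) = 0"
      by (rule bi_equivariant_eq_zero[OF f sigma_UTn[OF separated(2)] sigma_UTn[OF separated(1)]
            sigma_G[OF g]])
        (use separated in \<open>auto simp: theta_sigma UTn_carrier\<close>)
    then show ?thesis using bi_equivariant_eq_zero[OF f separated(1,2) g separated(3,4)] by simp
  next
    case (hessenberg A B)
    obtain u c where u: "u \<in> UTn n" and factor: "g = u * mat_poly n c B"
      by (rule hessenberg_intertwiner_factor[OF units hessenberg(1,2) gc hessenberg(3)
            G.carrierD[OF h(1)] h(3)])
    define z where "z = mat_poly n c B"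
    have z: "z \<in> carrier_mat n n" "g = u * z" by (simp_all add: z_def factor)
    have zG: "z \<in> G" using G.mult_left_mem_iff[of u z] u G(2) g z by auto
    obtain v where v: "v \<in> UTn n" "sigma z * v = v * z"
      unfolding z_def using sigma_hessenberg_conjugate[OF hessenberg(2)] by blast
    have "theta v * f (sigma z) = theta v * f z"
      using bi_equivariantD(2)[OF f v(1) sigma_G[OF zG]] bi_equivariantD(1)[OF f v(1) zG] v(2)
      by metis
    then have "f (sigma z) = f z" using theta_nonzero by simp
    moreover have "sigma g = sigma z * sigma u"
      unfolding z(2) by (rule sigma_mult[OF UTn_carrier[OF u] z(1)])
    ultimately show ?thesis
      using bi_equivariantD(2)[OF f sigma_UTn[OF u] sigma_G[OF zG]] bi_equivariantD(1)[OF f u zG]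
      by (simp add: z(2) theta_sigma UTn_carrier[OF u])
  qed
qed

lemma gelfand_pair_sigma:
  assumes G: "mat_group n G" "UTn n \<subseteq> G"
    and det: "\<And>g x. g \<in> G \<Longrightarrow> x \<in> carrier_mat n n \<Longrightarrow> det x = det g \<Longrightarrow> x \<in> G"
  shows "gelfand_pair n G (UTn n) theta sigma"
proof -
  interpret G: mat_group n G by (rule G(1))
  interpret UTn: mat_group n "UTn n :: 'r mat set" by (rule mat_group_UTn)
  have closed: "sigma ` G \<subseteq> G" using det det_sigma sigma_carrier G.carrierD by blast
  show ?thesis
  proof
    show "UTn n \<subseteq> G" by (rule G(2))
    show "sigma ` G = G"
    proof
      show "G \<subseteq> sigma ` G"
      proof
        fix y assume y: "y \<in> G"
        obtain x where x: "x \<in> carrier_mat n n" "sigma x = y"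
          by (rule sigma_surj[OF G.carrierD[OF y]])
        then have "x \<in> G" using det[OF y] det_sigma[OF x(1)] by simp
        then show "y \<in> sigma ` G" using x(2) by blast
      qed
    qed (rule closed)
    show "f (sigma g) = f g" if "bi_equivariant G (UTn n) theta f" "g \<in> G" for f g
      by (rule sigma_invariant[OF G closed that])
  qed (simp_all add: theta_mult theta_nonzero sigma_mult G.carrierD)
qed

end

section \<open>Groups of matrices with prescribed determinants\<close>

definition unit_group :: "'r::comm_ring_1 set \<Rightarrow> bool" where
  "unit_group H \<longleftrightarrow> 1 \<in> H \<and> (\<forall>x\<in>H. \<forall>y\<in>H. x * y \<in> H) \<and> (\<forall>x\<in>H. \<exists>y\<in>H. x * y = 1)"

definition mats_with_det_in :: "nat \<Rightarrow> 'r::comm_ring_1 set \<Rightarrow> 'r mat set" where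
  "mats_with_det_in n H = {A \<in> carrier_mat n n. det A \<in> H}"

lemma GLn_eq_mats_with_det_in: "GLn n = mats_with_det_in n {x. x dvd 1}"
  and SLn_eq_mats_with_det_in: "SLn n = mats_with_det_in n {1}"
  by (simp_all add: GLn_def SLn_def mats_with_det_in_def)

lemma unit_group_units: "unit_group {x. x dvd 1}" and unit_group_one: "unit_group {1}"
  by (auto simp: unit_group_def is_unit_mult_iff) (metis dvd_def mult.commute)

lemma UTn_subset_mats_with_det_in: "unit_group H \<Longrightarrow> UTn n \<subseteq> mats_with_det_in n H"
  by (auto simp: mats_with_det_in_def unit_group_def UTn_carrier dest: UTn_det)

lemma mat_group_mats_with_det_in:
  fixes H :: "'r::comm_ring_1 set"
  assumes H: "unit_group H"
  shows "mat_group n (mats_with_det_in n H)"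
proof
  show "1\<^sub>m n \<in> mats_with_det_in n H" using H by (simp add: mats_with_det_in_def unit_group_def)
  fix g :: "'r mat" assume g: "g \<in> mats_with_det_in n H"
  then have gc: "g \<in> carrier_mat n n" by (simp add: mats_with_det_in_def)
  show "g * h \<in> mats_with_det_in n H" if "h \<in> mats_with_det_in n H" for h
    using H g that by (auto simp: mats_with_det_in_def unit_group_def det_mult)
  obtain e where e: "e \<in> H" "det g * e = 1"
    using H g by (auto simp: mats_with_det_in_def unit_group_def)
  obtain h where h: "h \<in> carrier_mat n n" "g * h = 1\<^sub>m n" "h * g = 1\<^sub>m n"
    by (rule unit_det_obtain_inverse[OF gc e(2)])
  have "det g * det h = 1" using det_mult[OF gc h(1)] h(2) by simp
  then have "det h = e" using e(2) by (metis mult.assoc mult.commute mult_1_right)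
  then show "\<exists>h\<in>mats_with_det_in n H. g * h = 1\<^sub>m n \<and> h * g = 1\<^sub>m n"
    using e(1) h by (auto simp: mats_with_det_in_def)
qed (auto simp: mats_with_det_in_def)

section \<open>Multiplicity one over rings with generating characters\<close>

lemma gelfand_pair_cong:
  assumes "gelfand_pair n G U theta sigma" and eq: "\<And>u. u \<in> U \<Longrightarrow> theta' u = theta u"
  shows "gelfand_pair n G U theta' sigma"
proof -
  interpret gelfand_pair n G U theta sigma by (rule assms(1))
  have "bi_equivariant G U theta' f \<longleftrightarrow> bi_equivariant G U theta f" for f
    by (simp add: bi_equivariant_def eq)
  then show ?thesis
    using subgroup theta_mult theta_nonzero sigma_image sigma_mult sigma_invariant
    by unfold_locales (auto simp: eq U.mult_closed)
qed

lemma gelfand_pair_commutative: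
  assumes "mat_group n G" "mat_group n U" "U \<subseteq> G"
    and "\<And>u v. u \<in> U \<Longrightarrow> v \<in> U \<Longrightarrow> theta (u * v) = theta u * theta v"
    and "\<And>u. u \<in> U \<Longrightarrow> theta u \<noteq> 0"
    and "\<And>g h. g \<in> G \<Longrightarrow> h \<in> G \<Longrightarrow> g * h = h * g"
  shows "gelfand_pair n G U theta id"
  using assms by (intro gelfand_pair.intro gelfand_pair_axioms.intro) auto

lemma mult_mat_commute_dim_less_2:
  fixes A B :: "'r::comm_ring_1 mat"
  assumes "A \<in> carrier_mat n n" "B \<in> carrier_mat n n" "n < 2"
  shows "A * B = B * A"
  using assms
  by (intro eq_matI) (auto simp: scalar_prod_def mult.commute less_Suc_eq numeral_2_eq_2)

lemma gelfand_pair_nondeg_char: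
  fixes psi :: "nat \<Rightarrow> 'r::comm_ring_1 \<Rightarrow> complex"
  assumes fin: "finite (UNIV :: 'r set)" and psi: "\<forall>i<n - 1. generating_character (psi i)"
    and H: "unit_group H"
  obtains sigma where "gelfand_pair n (mats_with_det_in n H) (UTn n) (nondeg_char n psi) sigma"
proof (cases "n < 2")
  case True
  note group = mat_group_mats_with_det_in[OF H]
  have "gelfand_pair n (mats_with_det_in n H) (UTn n) (nondeg_char n psi) id"
    using True mat_group.carrierD[OF group]
    by (intro gelfand_pair_commutative group mat_group_UTn UTn_subset_mats_with_det_in H
        mult_mat_commute_dim_less_2) (auto simp: nondeg_char_def)
  then show thesis by (rule that)
next
  case False
  then have psi0: "generating_character (psi 0)" using psi by simp
  obtain a b where units: "\<And>i. a i * b i = 1"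
    and multiple: "\<And>i x. i < n - 1 \<Longrightarrow> psi i x = psi 0 (a i * x)"
    by (rule generating_characters_eq_unit_multiples[OF fin psi0 psi]) blast
  interpret nondegenerate_character n "psi 0" a b
    by (rule nondegenerate_character.intro[OF fin psi0 units])
  have "nondeg_char n psi u = theta u" if "u \<in> UTn n" for u
    unfolding nondeg_char_def theta_superdiag[OF UTn_carrier[OF that]]
      additive_character_sum[OF psi_additive] Suc_eq_plus1
    by (intro prod.cong refl multiple) simp
  moreover have "gelfand_pair n (mats_with_det_in n H) (UTn n) theta sigma"
    using mat_group_mats_with_det_in[OF H] UTn_subset_mats_with_det_in[OF H]
    by (rule gelfand_pair_sigma) (simp add: mats_with_det_in_def)
  ultimately show thesis using gelfand_pair_cong that by blast
qed

theorem nondeg_char_multiplicity_one: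
  fixes psi :: "nat \<Rightarrow> 'r::comm_ring_1 \<Rightarrow> complex"
  assumes fin: "finite (UNIV :: 'r set)" and psi: "\<forall>i<n - 1. generating_character (psi i)"
    and H: "unit_group H" and rho: "irreducible_rep n (mats_with_det_in n H) d rho"
  shows "hom_dim_le_1 (mats_with_det_in n H) (UTn n) (nondeg_char n psi) d rho"
proof -
  obtain sigma where pair: "gelfand_pair n (mats_with_det_in n H) (UTn n) (nondeg_char n psi) sigma"
    by (rule gelfand_pair_nondeg_char[OF fin psi H])
  have "finite (mats_with_det_in n H)"
    by (rule finite_subset[OF _ finite_carrier_mat[OF fin]]) (auto simp: mats_with_det_in_def)
  then interpret gelfand_pair_rep n "mats_with_det_in n H" "UTn n" "nondeg_char n psi" sigma d rho
    using pair mat_group_mats_with_det_in[OF H] rho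
    by (intro gelfand_pair_rep.intro irreducible_mat_rep.intro irreducible_mat_rep_axioms.intro)
  show ?thesis by (rule multiplicity_one)
qed

section \<open>Quotients of rings of integers\<close>

lemma finite_representatives_mod_power:
  fixes w :: "'a::idom"
  assumes fin: "finite ((UNIV :: 'a set) // {(x, y). w dvd (x - y)})"
  shows "\<exists>R. finite R \<and> (\<forall>x. \<exists>r\<in>R. w ^ k dvd x - r)"
proof (induction k)
  case 0
  then show ?case by (intro exI[of _ "{0}"]) simp
next
  case (Suc k)
  let ?E = "{(x, y). w dvd (x - y)}"
  define S where "S = (\<lambda>C. SOME y. y \<in> C) ` ((UNIV :: 'a set) // ?E)"
  have S: "\<exists>s\<in>S. w dvd y - s" for y
  proof
    have "y \<in> ?E `` {y}" by simp
    then have "(SOME z. z \<in> ?E `` {y}) \<in> ?E `` {y}" by (rule someI)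
    then show "w dvd y - (SOME z. z \<in> ?E `` {y})" by simp
    show "(SOME z. z \<in> ?E `` {y}) \<in> S"
      unfolding S_def by (rule image_eqI[OF refl]) (rule quotientI[OF UNIV_I])
  qed
  obtain R where R: "finite R" "\<And>x. \<exists>r\<in>R. w ^ k dvd x - r" using Suc by blast
  let ?T = "(\<lambda>(r, s). r + w ^ k * s) ` (R \<times> S)"
  have "\<exists>t\<in>?T. w ^ Suc k dvd x - t" for x
  proof -
    obtain r where r: "r \<in> R" "w ^ k dvd x - r" using R(2) by blast
    then obtain y where y: "x - r = w ^ k * y" by (auto elim: dvdE)
    obtain s where s: "s \<in> S" "w dvd y - s" using S by blast
    have "x - (r + w ^ k * s) = w ^ k * (y - s)" using y by (simp add: algebra_simps)
    then have "w ^ Suc k dvd x - (r + w ^ k * s)"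
      using s(2) by (simp add: mult.commute mult_dvd_mono)
    then show ?thesis using r(1) s(1) by force
  qed
  moreover have "finite ?T" using R(1) fin by (simp add: S_def)
  ultimately show ?case by blast
qed

context
  fixes w :: "'a::idom" and l :: nat and phi :: "'a \<Rightarrow> 'r::comm_ring_1"
  assumes w: "ring_of_integers_local_field w" and phi: "is_quotient_mod_power w l phi"
begin

lemma quotient_mod_power_one: "phi 1 = 1"
  and quotient_mod_power_add: "phi (x + y) = phi x + phi y"
  and quotient_mod_power_mult: "phi (x * y) = phi x * phi y"
  and quotient_mod_power_surj: "surj phi"
  and quotient_mod_power_eq_zero_iff: "phi x = 0 \<longleftrightarrow> w ^ l dvd x"
  using phi by (auto simp: is_quotient_mod_power_def)

lemma finite_quotient_mod_power: "finite (UNIV :: 'r set)"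
proof -
  have "finite ((UNIV :: 'a set) // {(x, y). w dvd (x - y)})"
    using w by (simp add: ring_of_integers_local_field_def)
  from finite_representatives_mod_power[OF this, of l]
  obtain R where R: "finite R" "\<And>x. \<exists>r\<in>R. w ^ l dvd x - r" by blast
  have "phi x \<in> phi ` R" for x
  proof -
    obtain r where r: "r \<in> R" "w ^ l dvd x - r" using R(2) by blast
    then have "phi (x - r) = 0" by (simp add: quotient_mod_power_eq_zero_iff)
    then have "phi x = phi r" using quotient_mod_power_add[of "x - r" r] by simp
    then show ?thesis using r(1) by simp
  qed
  then have "UNIV \<subseteq> phi ` R" using quotient_mod_power_surj by (metis surjD subsetI)
  then show ?thesis using R(1) by (meson finite_imageI finite_subset)
qed

lemma quotient_mod_power_unit_times_power:
  assumes x: "x \<noteq> 0"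
  obtains u v k where "u * v = 1" "x = u * phi w ^ k" "k < l"
proof -
  have power: "phi (y ^ k) = phi y ^ k" for y k
    by (induction k) (simp_all add: quotient_mod_power_one quotient_mod_power_mult)
  obtain y where y: "x = phi y" using quotient_mod_power_surj by blast
  then have "\<not> w ^ l dvd y" using x quotient_mod_power_eq_zero_iff by simp
  then have "y \<noteq> 0" by auto
  then obtain u k where u: "u dvd 1" "y = u * w ^ k"
    using w unfolding ring_of_integers_local_field_def by blast
  obtain v where "1 = u * v" using u(1) by (auto elim: dvdE)
  then have "phi u * phi v = 1"
    by (simp add: quotient_mod_power_mult[symmetric] quotient_mod_power_one)
  moreover have "x = phi u * phi w ^ k" by (simp add: y u(2) quotient_mod_power_mult power)
  moreover have "k < l"
    using \<open>\<not> w ^ l dvd y\<close> u(2) by (metis dvd_mult le_imp_power_dvd not_le)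
  ultimately show thesis by (rule that)
qed

lemma primitive_character_generating:
  assumes psi: "primitive_character (phi w) l psi"
  shows "generating_character psi"
  unfolding generating_character_def
proof (intro conjI allI impI)
  show "additive_character psi" using psi by (simp add: primitive_character_def)
  obtain y where y: "psi (phi w ^ (l - 1) * y) \<noteq> 1"
    using psi by (auto simp: primitive_character_def)
  fix x :: 'r assume "x \<noteq> 0"
  then obtain u v k where x: "u * v = 1" "x = u * phi w ^ k" "k < l"
    by (rule quotient_mod_power_unit_times_power)
  have "v * phi w ^ (l - 1 - k) * y * x = (u * v) * (phi w ^ (l - 1 - k) * phi w ^ k) * y"
    by (simp add: x(2) algebra_simps)
  also have "\<dots> = phi w ^ (l - 1) * y" using x(1,3) by (simp add: power_add[symmetric])
  finally show "\<exists>r. psi (r * x) \<noteq> 1" using y by metis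
qed

end

theorem theorem1p1:
  fixes w :: "'a::idom" and l n :: nat and phi :: "'a \<Rightarrow> 'r::comm_ring_1"
    and G :: "'r mat set" and psi :: "nat \<Rightarrow> 'r \<Rightarrow> complex"
    and d :: nat and rho :: "'r mat \<Rightarrow> complex mat"
  assumes "ring_of_integers_local_field w"
    and "l \<ge> 2"
    and "is_quotient_mod_power w l phi"
    and "G = GLn n \<or> G = SLn n"
    and "\<forall>i < n - 1. primitive_character (phi w) l (psi i)"
    and "irreducible_rep n G d rho"
  shows "hom_dim_le_1 G (UTn n) (nondeg_char n psi) d rho"
proof -
  obtain H where H: "unit_group H" "G = mats_with_det_in n H"
    using assms(4) GLn_eq_mats_with_det_in SLn_eq_mats_with_det_in unit_group_units unit_group_one
    by metis
  have "finite (UNIV :: 'r set)" by (rule finite_quotient_mod_power[OF assms(1,3)])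
  moreover have "\<forall>i<n - 1. generating_character (psi i)"
    using primitive_character_generating[OF assms(1,3)] assms(5) by blast
  ultimately show ?thesis
    using nondeg_char_multiplicity_one H assms(6) by blast
qed

end
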